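(* Let $f:\mathbb{R}^n\to\mathbb{R}$ be a twice differentiable function, let $\mathbf{M}:\mathbb{R}^n\to\mathbb{R}^{n\times n}$ be a symmetric positive definite metric, and consider the natural gradient system $$\dot{\mathbf{x}}=-\mathbf{M}(\mathbf{x})^{-1}\,\nabla f(\mathbf{x}).$$ If this system is contracting in some metric (not necessarily $\mathbf{M}$), then it converges exponentially to a unique global minimum of $f$; that is, $f$ has a unique global minimizer $\mathbf{x}^\star$, and every solution of the system converges exponentially to $\mathbf{x}^\star$.
   Context: All functions are assumed sufficiently smooth that derivatives of the necessary order exist and are continuous. A metric is a function $\mathbf{P}:\mathbb{R}^n\to\mathbb{R}^{n\times n}$ whose values are symmetric positive definite matrices. A system $\dot{\mathbf{x}}=\mathbf{h}(\mathbf{x},t)$ on $\mathbb{R}^n$ is contracting at rate $\alpha>0$ with respect to the metric $\mathbf{P}$ if for all $t\in\mathbb{R}$ and all $\mathbf{x}\in\mathbb{R}^n$, $$\dot{\mathbf{P}}+\mathbf{A}^\top\mathbf{P}+\mathbf{P}\mathbf{A}\preceq -2\alpha\mathbf{P},$$ where $\mathbf{A}(\mathbf{x},t)=\frac{\partial \mathbf{h}}{\partial\mathbf{x}}$ and $\dot{\mathbf{P}}=\sum_i \frac{\partial\mathbf{P}}{\partial x_i}h_i(\mathbf{x},t)$. "Contracting in some metric" means that there exist such a metric $\mathbf{P}$ and a rate $\alpha>0$. Exponential convergence of two solutions $\mathbf{x}_1(t),\mathbf{x}_2(t)$ is understood in the geodesic distance $d_{\mathbf{P}}$ of the Riemannian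 manifold $(\mathbb{R}^n,\mathbf{P})$: $d_{\mathbf{P}}(\mathbf{x}_1(t),\mathbf{x}_2(t))\le e^{-\alpha t}d_{\mathbf{P}}(\mathbf{x}_1(0),\mathbf{x}_2(0))$.
   Formalization: The contraction metric P is additionally assumed complete (R^n is complete under the geodesic distance d_P). Without this the claim fails: for n=1, f(x)=-x, M=1, P(x)=exp(-2x), the system x'=1 is contracting at rate 1, but f has no minimizer. *)

theory Defs
  imports "HOL-Analysis.Analysis"
begin

section \<open>Smoothness and gradients\<close>

text \<open>In finite dimension, continuity of all directional derivatives of a differentiable function
  is continuity of its derivative.\<close>

definition C1 :: "('a::euclidean_space \<Rightarrow> 'b::real_normed_vector) \<Rightarrow> bool" where
  "C1 g \<longleftrightarrow> (\<forall>x. g differentiable (at x)) \<and>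
     (\<forall>v. continuous_on UNIV (\<lambda>x. frechet_derivative g (at x) v))"

definition grad :: "(real^'n \<Rightarrow> real) \<Rightarrow> real^'n \<Rightarrow> real^'n" where
  "grad f x = (\<chi> i. frechet_derivative f (at x) (axis i 1))"

definition C2 :: "(real^'n \<Rightarrow> real) \<Rightarrow> bool" where
  "C2 f \<longleftrightarrow> C1 f \<and> C1 (grad f)"

section \<open>Metrics\<close>

definition sym_pos_def :: "real^'n^'n \<Rightarrow> bool" where
  "sym_pos_def B \<longleftrightarrow> transpose B = B \<and> (\<forall>v. v \<noteq> 0 \<longrightarrow> 0 < v \<bullet> (B *v v))"

text \<open>The semidefinite order \<open>B \<preceq> C\<close>; it is only used for symmetric matrices.\<close>

definition loewner_le :: "real^'n^'n \<Rightarrow> real^'n^'n \<Rightarrow> bool" (infix "\<preceq>\<^sub>L" 50) where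
  "B \<preceq>\<^sub>L C \<longleftrightarrow> (\<forall>v. 0 \<le> v \<bullet> ((C - B) *v v))"

definition riemannian_metric :: "(real^'n \<Rightarrow> real^'n^'n) \<Rightarrow> bool" where
  "riemannian_metric P \<longleftrightarrow> C1 P \<and> (\<forall>x. sym_pos_def (P x))"

text \<open>The length is taken with \<open>has_integral\<close> rather than with \<open>integral\<close>: the derivative of a
  \<open>valid_path\<close> may be unbounded near its finitely many exceptional parameters, the speed may
  then fail to be integrable, and \<open>integral\<close> would give such a path of infinite length the
  value 0. Here it is simply not a competitor.\<close>

definition has_length :: "(real^'n \<Rightarrow> real^'n^'n) \<Rightarrow> (real \<Rightarrow> real^'n) \<Rightarrow> real \<Rightarrow> bool" where
  "has_length P \<gamma> L \<longleftrightarrow>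
     ((\<lambda>s. sqrt (vector_derivative \<gamma> (at s) \<bullet> (P (\<gamma> s) *v vector_derivative \<gamma> (at s))))
        has_integral L) {0..1}"

definition geodesic_dist :: "(real^'n \<Rightarrow> real^'n^'n) \<Rightarrow> real^'n \<Rightarrow> real^'n \<Rightarrow> real" where
  "geodesic_dist P x y =
     Inf {L. \<exists>\<gamma>. valid_path \<gamma> \<and> pathstart \<gamma> = x \<and> pathfinish \<gamma> = y \<and> has_length P \<gamma> L}"

text \<open>By Hopf and Rinow this is the same as geodesic completeness. Every uniformly positive definite
  metric (\<open>P x \<succeq> c I\<close> with \<open>c > 0\<close>) is complete.\<close>

definition complete_metric :: "(real^'n \<Rightarrow> real^'n^'n) \<Rightarrow> bool" where
  "complete_metric P \<longleftrightarrow> Metric_space.mcomplete UNIV (geodesic_dist P)"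

section \<open>Systems and contraction\<close>

text \<open>A system \<open>x' = h x t\<close> is represented by its right-hand side \<open>h\<close>.\<close>

definition metric_rate ::
  "(real^'n \<Rightarrow> real^'n^'n) \<Rightarrow> (real^'n \<Rightarrow> real \<Rightarrow> real^'n) \<Rightarrow> real^'n \<Rightarrow> real \<Rightarrow> real^'n^'n" where
  "metric_rate P h x t = (\<Sum>i\<in>UNIV. (h x t $ i) *\<^sub>R frechet_derivative P (at x) (axis i 1))"

definition contracting ::
  "(real^'n \<Rightarrow> real \<Rightarrow> real^'n) \<Rightarrow> (real^'n \<Rightarrow> real^'n^'n) \<Rightarrow> real \<Rightarrow> bool" where
  "contracting h P \<alpha> \<longleftrightarrow> riemannian_metric P \<and> 0 < \<alpha> \<and>
     (\<forall>t x. let A = jacobian (\<lambda>y. h y t) (at x) in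
        metric_rate P h x t + transpose A ** P x + P x ** A \<preceq>\<^sub>L (- 2 * \<alpha>) *\<^sub>R P x)"

definition solution :: "(real^'n \<Rightarrow> real \<Rightarrow> real^'n) \<Rightarrow> (real \<Rightarrow> real^'n) \<Rightarrow> bool" where
  "solution h x \<longleftrightarrow> (\<forall>t\<ge>0. (x has_vector_derivative h (x t) t) (at t within {0..}))"

definition exp_convergent ::
  "(real^'n \<Rightarrow> real^'n^'n) \<Rightarrow> real \<Rightarrow> (real \<Rightarrow> real^'n) \<Rightarrow> (real \<Rightarrow> real^'n) \<Rightarrow> bool" where
  "exp_convergent P \<alpha> x y \<longleftrightarrow>
     (\<forall>t\<ge>0. geodesic_dist P (x t) (y t) \<le> exp (- \<alpha> * t) * geodesic_dist P (x 0) (y 0))"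

definition natural_gradient ::
  "(real^'n \<Rightarrow> real^'n^'n) \<Rightarrow> (real^'n \<Rightarrow> real) \<Rightarrow> real^'n \<Rightarrow> real \<Rightarrow> real^'n" where
  "natural_gradient M f x t = - (matrix_inv (M x) *v grad f x)"

definition global_minimizer :: "('a \<Rightarrow> real) \<Rightarrow> 'a \<Rightarrow> bool" where
  "global_minimizer f x \<longleftrightarrow> (\<forall>y. f x \<le> f y)"

text \<open>Completeness of the contraction metric cannot be dropped from convergence statements. On the
  line, \<open>f x = - x\<close> with \<open>M x = 1\<close> gives the system \<open>x' = 1\<close>, which satisfies the contraction
  inequality at rate 1 for the incomplete metric \<open>P x = exp (- 2 * x)\<close>: there
  \<open>P' h + 2 A P = - 2 P\<close> with \<open>h = 1\<close> and \<open>A = 0\<close>. But \<open>f\<close> has no minimizer.\<close>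

end

theory Submission
  imports Defs
begin

text \<open>The velocity of a solution solves the linearised system, so its norm in the metric \<open>P\<close> decays
  exponentially and solutions have finite length. Balls of a complete metric are bounded, hence
  solutions exist for all times and accumulate at an equilibrium. Along a curve, the Euler map
  \<open>x \<mapsto> x + \<tau> h x\<close> shrinks lengths by the factor \<open>1 - (\<alpha> - \<epsilon>) \<tau>\<close>, uniformly on compact sets; letting
  \<open>\<tau>\<close> and \<open>\<epsilon>\<close> tend to 0 gives the convergence rate towards the equilibrium without differentiating
  the flow with respect to its initial value. Finally \<open>f\<close> decreases along solutions, so the
  equilibrium is a global minimizer, and every minimizer is an equilibrium.\<close>

text \<open>The field is autonomous, so one solution supplies its own tangent vector:
  \<open>contraction\<close> at \<open>v = h x\<close> is the differential inequality for the
  squared speed, and an equilibrium is found before any two solutions are compared. Afterwards every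
  comparison is with that equilibrium, which all Euler maps fix: of a curve from it to
  \<open>x\<close>, only the end at \<open>x\<close> is moved. Bounded balls serve twice: they trap
  solutions, and they provide the compact sets on which the Euler estimate is uniform. Completeness
  alone would not bound them: the distance \<open>min 1 (dist x y)\<close> on the line is complete,
  and its ball of radius 2 is everything. The argument of Hopf and Rinow uses that geodesic
  distances are infima of lengths, so that a curve can be cut at any prescribed length.\<close>

lemma C1_has_derivative:
  "C1 g \<Longrightarrow> (g has_derivative frechet_derivative g (at x)) (at x)"
  by (simp add: C1_def frechet_derivative_works)

lemma C1I:
  assumes "\<And>x. (g has_derivative g' x) (at x)" "\<And>v. continuous_on UNIV (\<lambda>x. g' x v)"
  shows "C1 g"
proof -
  have "frechet_derivative g (at x) = g' x" for x
    using frechet_derivative_at[OF assms(1)] by simp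
  then show ?thesis
    using assms by (auto simp: C1_def differentiable_def)
qed

lemma C1_continuous_on: "C1 g \<Longrightarrow> continuous_on S g"
  by (metis C1_def continuous_at_imp_continuous_on differentiable_imp_continuous_within)

text \<open>Joint continuity of the derivative in point and direction reduces to finitely many fixed
  directions, and for these \<open>C1\<close> provides continuity in the point.\<close>

lemma C1_derivative_expansion:
  assumes "C1 g"
  shows "frechet_derivative g (at x) v = (\<Sum>b\<in>Basis. (v \<bullet> b) *\<^sub>R frechet_derivative g (at x) b)"
proof -
  interpret linear "frechet_derivative g (at x)"
    using C1_has_derivative[OF assms] has_derivative_linear by blast
  have "frechet_derivative g (at x) v = frechet_derivative g (at x) (\<Sum>b\<in>Basis. (v \<bullet> b) *\<^sub>R b)"
    by (simp add: euclidean_representation)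
  then show ?thesis by (simp add: sum scaleR)
qed

lemma C1_derivative_continuous:
  assumes "C1 g"
  shows "continuous_on S (\<lambda>(x, v). frechet_derivative g (at x) v)"
proof -
  have "continuous_on S (\<lambda>z. frechet_derivative g (at (fst z)) b)" for b
    using assms unfolding C1_def
    by (intro continuous_on_compose2[of UNIV "\<lambda>x. frechet_derivative g (at x) b" S fst])
       (auto intro: continuous_intros)
  then show ?thesis
    unfolding case_prod_unfold
    by (subst C1_derivative_expansion[OF assms]) (intro continuous_intros)
qed

lemma continuous_on_C1_derivative:
  assumes "C1 g" "continuous_on S x" "continuous_on S v"
  shows "continuous_on S (\<lambda>s. frechet_derivative g (at (x s)) (v s))"
  using continuous_on_compose2[OF C1_derivative_continuous[OF assms(1), of UNIV]
      continuous_on_Pair[OF assms(2,3)]] by auto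

section \<open>Quadratic forms of a metric\<close>

lemma bounded_bilinear_matrix_vector_mult:
  "bounded_bilinear (\<lambda>(A::real^'n^'m) x. A *v x)"
proof -
  have "bilinear (\<lambda>(A::real^'n^'m) x. A *v x)"
    unfolding bilinear_def linear_iff
    by (simp add: matrix_vector_mult_add_rdistrib matrix_vector_right_distrib
        scaleR_matrix_vector_assoc matrix_vector_mult_scaleR)
  then show ?thesis by (simp add: bilinear_conv_bounded_bilinear)
qed

lemmas continuous_on_matrix_vector_mult [continuous_intros] =
  bounded_bilinear.continuous_on[OF bounded_bilinear_matrix_vector_mult]
lemmas has_derivative_matrix_vector_mult =
  bounded_bilinear.FDERIV[OF bounded_bilinear_matrix_vector_mult]
lemmas has_vector_derivative_matrix_vector_mult =
  bounded_bilinear.has_vector_derivative[OF bounded_bilinear_matrix_vector_mult]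

lemma metric_form_nonneg: "sym_pos_def B \<Longrightarrow> 0 \<le> v \<bullet> (B *v v)"
  by (cases "v = 0") (auto simp: sym_pos_def_def intro: less_imp_le)

lemma metric_form_commute: "sym_pos_def B \<Longrightarrow> v \<bullet> (B *v w) = w \<bullet> (B *v v)"
  unfolding sym_pos_def_def by (metis dot_lmul_matrix inner_commute transpose_matrix_vector)

lemma riemannian_metric_continuous_on: "riemannian_metric P \<Longrightarrow> continuous_on S P"
  by (simp add: riemannian_metric_def C1_continuous_on)

text \<open>The form attains a positive minimum and a maximum on the compact product of
  \<open>K\<close> with the unit sphere; homogeneity of degree 2 extends the bounds to all
  \<open>v\<close>. The constants are squared so that square roots give bounds on
  \<open>metric_norm\<close>.\<close>

lemma metric_form_compact_bounds:
  fixes P :: "real^'n \<Rightarrow> real^'n^'n"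
  assumes P: "riemannian_metric P" and K: "compact K"
  obtains m B where "0 < m" "0 < B"
    "\<And>x v. x \<in> K \<Longrightarrow> m\<^sup>2 * (norm v)\<^sup>2 \<le> v \<bullet> (P x *v v)"
    "\<And>x v. x \<in> K \<Longrightarrow> v \<bullet> (P x *v v) \<le> B\<^sup>2 * (norm v)\<^sup>2"
proof (cases "K = {}")
  case True
  then show ?thesis using that[of 1 1] by auto
next
  case False
  let ?C = "K \<times> sphere (0::real^'n) 1"
  let ?q = "\<lambda>z. snd z \<bullet> (P (fst z) *v snd z)"
  have C: "compact ?C" "?C \<noteq> {}"
    using K False by (auto intro: compact_Times)
  have cont: "continuous_on ?C ?q"
    by (intro continuous_intros continuous_on_compose2[OF riemannian_metric_continuous_on[OF P, of UNIV]]) auto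
  obtain z1 where z1: "z1 \<in> ?C" "\<And>z. z \<in> ?C \<Longrightarrow> ?q z1 \<le> ?q z"
    using continuous_attains_inf[OF C cont] by blast
  obtain z2 where z2: "z2 \<in> ?C" "\<And>z. z \<in> ?C \<Longrightarrow> ?q z \<le> ?q z2"
    using continuous_attains_sup[OF C cont] by blast
  have pos: "0 < ?q z1"
    using z1(1) P unfolding riemannian_metric_def sym_pos_def_def
    by (metis SigmaE fst_conv mem_sphere_0 norm_zero snd_conv zero_neq_one)
  moreover have "?q z1 \<le> ?q z2" using z2 z1 by blast
  ultimately have pos2: "0 < ?q z2" by linarith
  have *: "?q z1 * (norm v)\<^sup>2 \<le> v \<bullet> (P x *v v) \<and> v \<bullet> (P x *v v) \<le> ?q z2 * (norm v)\<^sup>2" if "x \<in> K" for x v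
  proof (cases "v = 0")
    case False
    define w where "w = (1 / norm v) *\<^sub>R v"
    have v: "v = norm v *\<^sub>R w" using False by (simp add: w_def)
    have "(x, w) \<in> ?C" using that False by (simp add: w_def)
    then have "?q z1 \<le> w \<bullet> (P x *v w)" "w \<bullet> (P x *v w) \<le> ?q z2"
      using z1(2) z2(2) by force+
    moreover have "v \<bullet> (P x *v v) = (norm v)\<^sup>2 * (w \<bullet> (P x *v w))"
      by (subst (1 2) v) (simp add: matrix_vector_mult_scaleR power2_eq_square)
    ultimately show ?thesis
      by (metis mult.commute mult_left_mono zero_le_power2)
  qed auto
  show ?thesis
    using that[of "sqrt (?q z1)" "sqrt (?q z2)"] pos pos2 * by auto
qed

section \<open>Lengths of curves\<close>

definition metric_norm :: "(real^'n \<Rightarrow> real^'n^'n) \<Rightarrow> real^'n \<Rightarrow> real^'n \<Rightarrow> real" where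
  "metric_norm P x v = sqrt (v \<bullet> (P x *v v))"

lemma metric_norm_nonneg: "riemannian_metric P \<Longrightarrow> 0 \<le> metric_norm P x v"
  by (simp add: metric_norm_def riemannian_metric_def metric_form_nonneg)

lemma metric_norm_scaleR: "metric_norm P x (c *\<^sub>R v) = \<bar>c\<bar> * metric_norm P x v"
  by (simp add: metric_norm_def matrix_vector_mult_scaleR real_sqrt_mult flip: mult.assoc)

lemma continuous_on_metric_norm:
  assumes "riemannian_metric P" "continuous_on S x" "continuous_on S v"
  shows "continuous_on S (\<lambda>s. metric_norm P (x s) (v s))"
  unfolding metric_norm_def using assms
  by (intro continuous_intros continuous_on_compose2[OF riemannian_metric_continuous_on[of P UNIV]]) auto

lemma metric_norm_compact_bounds:
  assumes P: "riemannian_metric P" and K: "compact K"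
  obtains m B where "0 < m" "0 < B"
    "\<And>x v. x \<in> K \<Longrightarrow> m * norm v \<le> metric_norm P x v"
    "\<And>x v. x \<in> K \<Longrightarrow> metric_norm P x v \<le> B * norm v"
proof -
  obtain m B where *: "0 < m" "0 < B"
    "\<And>x v. x \<in> K \<Longrightarrow> m\<^sup>2 * (norm v)\<^sup>2 \<le> v \<bullet> (P x *v v)"
    "\<And>x v. x \<in> K \<Longrightarrow> v \<bullet> (P x *v v) \<le> B\<^sup>2 * (norm v)\<^sup>2"
    using metric_form_compact_bounds[OF assms] by metis
  show ?thesis
  proof (rule that[OF *(1,2)])
    fix x v assume x: "x \<in> K"
    show "m * norm v \<le> metric_norm P x v"
      unfolding metric_norm_def using *(3)[OF x, of v]
      by (intro real_le_rsqrt) (simp add: power_mult_distrib)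
    show "metric_norm P x v \<le> B * norm v"
      unfolding metric_norm_def using *(4)[OF x, of v] *(2)
      by (intro real_le_lsqrt) (simp_all add: power_mult_distrib)
  qed
qed

text \<open>A working form of \<open>valid_path\<close> with \<open>has_length\<close>. An arbitrary
  parameter interval and an explicit derivative \<open>g'\<close> make cutting, joining and
  reparametrising direct. The derivative is two-sided, so an endpoint with only a one-sided
  derivative has to be put into the exceptional set \<open>S\<close>.\<close>

definition curve_length ::
  "(real^'n \<Rightarrow> real^'n^'n) \<Rightarrow> (real \<Rightarrow> real^'n) \<Rightarrow> real \<Rightarrow> real \<Rightarrow> real \<Rightarrow> bool" where
  "curve_length P g a b L \<longleftrightarrow> a \<le> b \<and> continuous_on {a..b} g \<and>
     (\<exists>S g'. finite S \<and> (\<forall>s\<in>{a..b} - S. (g has_vector_derivative g' s) (at s)) \<and>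
        continuous_on ({a..b} - S) g' \<and>
        ((\<lambda>s. metric_norm P (g s) (g' s)) has_integral L) {a..b})"

lemma curve_lengthE:
  assumes "curve_length P g a b L"
  obtains S g' where "a \<le> b" "continuous_on {a..b} g" "finite S"
    "\<And>s. s \<in> {a..b} - S \<Longrightarrow> (g has_vector_derivative g' s) (at s)"
    "continuous_on ({a..b} - S) g'"
    "((\<lambda>s. metric_norm P (g s) (g' s)) has_integral L) {a..b}"
  using assms unfolding curve_length_def by metis

lemma curve_lengthI:
  assumes "a \<le> b" "continuous_on {a..b} g" "finite S"
    "\<And>s. s \<in> {a..b} - S \<Longrightarrow> (g has_vector_derivative g' s) (at s)"
    "continuous_on ({a..b} - S) g'"
    "((\<lambda>s. metric_norm P (g s) (g' s)) has_integral L) {a..b}"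
  shows "curve_length P g a b L"
  using assms unfolding curve_length_def by metis

lemma curve_length_nonneg:
  assumes "riemannian_metric P" "curve_length P g a b L" shows "0 \<le> L"
  using assms(2) by (elim curve_lengthE) (meson has_integral_nonneg metric_norm_nonneg assms(1))

text \<open>The chain rule multiplies the speed by the absolute value of \<open>c\<close>, and
  substitution divides the integral by it. A negative \<open>c\<close> is allowed, which covers
  reversal.\<close>

lemma curve_length_affine:
  assumes "curve_length P g a b L" and c: "c \<noteq> 0" and im: "(\<lambda>s. c * s + e) ` {a'..b'} = {a..b}"
  shows "curve_length P (\<lambda>s. g (c * s + e)) a' b' L"
  using assms(1)
proof (rule curve_lengthE)
  fix S g'
  assume ab: "a \<le> b" and cont: "continuous_on {a..b} g" and S: "finite S"
    and der: "\<And>s. s \<in> {a..b} - S \<Longrightarrow> (g has_vector_derivative g' s) (at s)"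
    and cont': "continuous_on ({a..b} - S) g'"
    and int: "((\<lambda>s. metric_norm P (g s) (g' s)) has_integral L) {a..b}"
  define T where "T = (\<lambda>s. c * s + e) -` S"
  have inj: "inj (\<lambda>s. c * s + e)" using c by (auto simp: inj_def)
  have in_ab: "c * s + e \<in> {a..b}" if "s \<in> {a'..b'}" for s
    using im that by blast
  \<comment> \<open>\<open>has_integral_affinity\<close> yields the new domain as an image under the
    inverse affine map.\<close>
  have inv_im: "(\<lambda>x. (1 / c) *\<^sub>R x + - ((1 / c) *\<^sub>R e)) ` {a..b} = {a'..b'}"
  proof -
    have "(1 / c) *\<^sub>R (c * x + e) + - ((1 / c) *\<^sub>R e) = x" for x
      using c by (simp add: divide_simps)
    then show ?thesis
      unfolding im[symmetric] image_image by (intro trans[OF image_cong[OF refl] image_ident])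
  qed
  show ?thesis
  proof (rule curve_lengthI)
    show "a' \<le> b'" using im ab by force
    show "continuous_on {a'..b'} (\<lambda>s. g (c * s + e))"
      by (intro continuous_on_compose2[OF cont] continuous_intros) (use in_ab in auto)
    show "finite T" unfolding T_def using S inj by (rule finite_vimageI)
    show "((\<lambda>s. g (c * s + e)) has_vector_derivative c *\<^sub>R g' (c * s + e)) (at s)"
      if "s \<in> {a'..b'} - T" for s
    proof -
      have "((\<lambda>s. c * s + e) has_vector_derivative c) (at s)"
        by (auto intro!: derivative_eq_intros simp flip: has_real_derivative_iff_has_vector_derivative)
      from vector_diff_chain_at[OF this, of g] der[of "c * s + e"] that in_ab[of s]
      show ?thesis by (auto simp: T_def o_def)
    qed
    show "continuous_on ({a'..b'} - T) (\<lambda>s. c *\<^sub>R g' (c * s + e))"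
      by (intro continuous_intros continuous_on_compose2[OF cont']) (use in_ab T_def in auto)
    have "((\<lambda>s. metric_norm P (g (c *\<^sub>R s + e)) (g' (c *\<^sub>R s + e)))
        has_integral (1 / (\<bar>c\<bar> ^ DIM(real))) *\<^sub>R L) {a'..b'}"
      using has_integral_affinity[OF int[folded cbox_interval] c, of e]
      unfolding cbox_interval inv_im .
    from has_integral_mult_right[OF this, of "\<bar>c\<bar>"]
    show "((\<lambda>s. metric_norm P (g (c * s + e)) (c *\<^sub>R g' (c * s + e))) has_integral L) {a'..b'}"
      using c by (simp add: metric_norm_scaleR)
  qed
qed

lemma curve_length_reverse:
  assumes "curve_length P g 0 1 L"
  shows "curve_length P (\<lambda>s. g (1 - s)) 0 1 L"
proof -
  have "(\<lambda>s::real. -1 * s + 1) ` {0..1} = {0..1}"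
    by (auto simp: image_iff intro!: bexI[of _ "1 - _"])
  from curve_length_affine[OF assms _ this] show ?thesis by simp
qed

lemma curve_length_join:
  assumes g: "curve_length P g a b L" and k: "curve_length P k b c L'" and eq: "g b = k b"
  shows "curve_length P (\<lambda>s. if s \<le> b then g s else k s) a c (L + L')"
proof -
  let ?j = "\<lambda>s. if s \<le> b then g s else k s"
  obtain S g' where G: "a \<le> b" "continuous_on {a..b} g" "finite S"
    "\<And>s. s \<in> {a..b} - S \<Longrightarrow> (g has_vector_derivative g' s) (at s)"
    "continuous_on ({a..b} - S) g'"
    "((\<lambda>s. metric_norm P (g s) (g' s)) has_integral L) {a..b}"
    using curve_lengthE[OF g] by metis
  obtain T k' where K: "b \<le> c" "continuous_on {b..c} k" "finite T"
    "\<And>s. s \<in> {b..c} - T \<Longrightarrow> (k has_vector_derivative k' s) (at s)"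
    "continuous_on ({b..c} - T) k'"
    "((\<lambda>s. metric_norm P (k s) (k' s)) has_integral L') {b..c}"
    using curve_lengthE[OF k] by metis
  define j' where "j' = (\<lambda>s. if s < b then g' s else k' s)"
  \<comment> \<open>The two derivatives need not agree at the joint, so \<open>b\<close> becomes
    exceptional. Without \<open>b\<close> the two halves are disjoint and relatively closed, which
    makes \<open>j'\<close> continuous on their union.\<close>
  define U where "U = insert b (S \<union> T)"
  show ?thesis
  proof (rule curve_lengthI)
    show "a \<le> c" using G(1) K(1) by simp
    have "continuous_on ({a..b} \<union> {b..c}) ?j"
      by (rule continuous_on_cases) (use G K eq in auto)
    then show "continuous_on {a..c} ?j"
      by (simp add: ivl_disj_un_two_touch G(1) K(1))
    show "finite U" using G(3) K(3) by (simp add: U_def)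
    show "(?j has_vector_derivative j' s) (at s)" if s: "s \<in> {a..c} - U" for s
    proof (cases "s < b")
      case True
      then have "(g has_vector_derivative j' s) (at s)"
        using G(4)[of s] s by (auto simp: U_def j'_def)
      then show ?thesis
        by (rule has_vector_derivative_transform_within_open[of _ _ _ "{..<b}"]) (use True in auto)
    next
      case False
      then have "b < s" using s by (auto simp: U_def)
      then have "(k has_vector_derivative j' s) (at s)"
        using K(4)[of s] s by (auto simp: U_def j'_def)
      then show ?thesis
        by (rule has_vector_derivative_transform_within_open[of _ _ _ "{b<..}"]) (use \<open>b < s\<close> in auto)
    qed
    have "continuous_on ({a..b} - U) j'"
      by (rule continuous_on_eq[OF continuous_on_subset[OF G(5)]]) (auto simp: U_def j'_def)
    moreover have "continuous_on ({b..c} - U) j'"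
      by (rule continuous_on_eq[OF continuous_on_subset[OF K(5)]]) (auto simp: U_def j'_def)
    moreover have "{a..c} - U = ({a..b} - U) \<union> ({b..c} - U)"
      using G(1) K(1) by auto
    moreover have "closedin (top_of_set ({a..c} - U)) ({a..b} - U)"
      using K(1) by (auto simp: closedin_closed intro!: exI[of _ "{a..b}"])
    moreover have "closedin (top_of_set ({a..c} - U)) ({b..c} - U)"
      using G(1) by (auto simp: closedin_closed intro!: exI[of _ "{b..c}"])
    ultimately show "continuous_on ({a..c} - U) j'"
      using continuous_on_cases_local[of "{a..b} - U" "{b..c} - U" j' j' "\<lambda>_. True"] by simp
    have "((\<lambda>s. metric_norm P (?j s) (j' s)) has_integral L) {a..b}"
      by (rule has_integral_spike_finite[OF _ _ G(6), of "{b}"]) (auto simp: j'_def)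
    moreover have "((\<lambda>s. metric_norm P (?j s) (j' s)) has_integral L') {b..c}"
      by (rule has_integral_spike_finite[OF _ _ K(6), of "{b}"]) (auto simp: j'_def)
    ultimately show "((\<lambda>s. metric_norm P (?j s) (j' s)) has_integral (L + L')) {a..c}"
      using has_integral_combine[OF G(1) K(1)] by blast
  qed
qed

text \<open>\<open>len\<close> is arc length, the indefinite integral of the speed. Its continuity
  allows a curve to be cut at a prescribed length by the intermediate value theorem.\<close>

lemma curve_length_split:
  assumes g: "curve_length P g a b L"
  obtains len where "continuous_on {a..b} len" "len a = 0" "len b = L"
    "\<And>s. s \<in> {a..b} \<Longrightarrow> curve_length P g a s (len s)"
    "\<And>s. s \<in> {a..b} \<Longrightarrow> curve_length P g s b (L - len s)"
proof -
  obtain S g' where G: "a \<le> b" "continuous_on {a..b} g" "finite S"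
    "\<And>s. s \<in> {a..b} - S \<Longrightarrow> (g has_vector_derivative g' s) (at s)"
    "continuous_on ({a..b} - S) g'"
    "((\<lambda>s. metric_norm P (g s) (g' s)) has_integral L) {a..b}"
    using curve_lengthE[OF g] by metis
  define f where "f = (\<lambda>s. metric_norm P (g s) (g' s))"
  have int: "f integrable_on {a..b}" and L: "integral {a..b} f = L"
    using G(6) by (auto simp: f_def integrable_on_def)
  show ?thesis
  proof (rule that[of "\<lambda>s. integral {a..s} f"])
    show "continuous_on {a..b} (\<lambda>s. integral {a..s} f)"
      by (rule indefinite_integral_continuous_1[OF int])
    show "integral {a..a} f = 0" by simp
    show "integral {a..b} f = L" by (rule L)
  next
    fix s assume s: "s \<in> {a..b}"
    have i1: "f integrable_on {a..s}" and i2: "f integrable_on {s..b}"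
      using integrable_on_subinterval[OF int] s by auto
    have "integral {a..s} f + integral {s..b} f = L"
      using Henstock_Kurzweil_Integration.integral_combine[OF _ _ int, of s] s L by auto
    then have sb: "integral {s..b} f = L - integral {a..s} f" by simp
    show "curve_length P g a s (integral {a..s} f)"
    proof (rule curve_lengthI[OF _ _ G(3)])
      show "((\<lambda>s. metric_norm P (g s) (g' s)) has_integral integral {a..s} f) {a..s}"
        using i1 unfolding f_def by (rule integrable_integral)
    qed (use s G in \<open>auto intro: continuous_on_subset\<close>)
    show "curve_length P g s b (L - integral {a..s} f)"
    proof (rule curve_lengthI[OF _ _ G(3)])
      show "((\<lambda>s. metric_norm P (g s) (g' s)) has_integral L - integral {a..s} f) {s..b}"
        using integrable_integral[OF i2] unfolding sb by (simp add: f_def)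
    qed (use s G in \<open>auto intro: continuous_on_subset\<close>)
  qed
qed

text \<open>Off \<open>S\<close> the witness \<open>g'\<close> must agree with
  \<open>vector_derivative g\<close>, and the finitely many points of \<open>S\<close> do not affect
  the integral. This ties the working notion to the definition of
  \<open>geodesic_dist\<close>.\<close>

lemma curve_length_iff_path:
  "curve_length P g 0 1 L \<longleftrightarrow> valid_path g \<and> has_length P g L"
proof
  assume "curve_length P g 0 1 L"
  then show "valid_path g \<and> has_length P g L"
  proof (rule curve_lengthE)
    fix S g'
    assume G: "continuous_on {0..1} g" "finite S"
      "\<And>s. s \<in> {0..1} - S \<Longrightarrow> (g has_vector_derivative g' s) (at s)"
      "continuous_on ({0..1} - S) g'"
      "((\<lambda>s. metric_norm P (g s) (g' s)) has_integral L) {0..1}"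
    have "g C1_differentiable_on ({0..1} - S)"
      unfolding C1_differentiable_on_def using G by blast
    then have "valid_path g"
      unfolding valid_path_def piecewise_C1_differentiable_on_def using G by blast
    moreover have "has_length P g L"
      unfolding has_length_def
      by (rule has_integral_spike_finite[OF G(2) _ G(5)])
         (use G(3) vector_derivative_at in \<open>force simp: metric_norm_def\<close>)
    ultimately show ?thesis by blast
  qed
next
  assume *: "valid_path g \<and> has_length P g L"
  then obtain S where S: "finite S" "continuous_on {0..1} g" "g C1_differentiable_on ({0..1} - S)"
    by (auto simp: valid_path_def piecewise_C1_differentiable_on_def)
  show "curve_length P g 0 1 L"
    by (rule curve_lengthI[OF _ S(2,1), where g' = "\<lambda>s. vector_derivative g (at s)"])
       (use * S in \<open>auto simp: has_length_def metric_norm_def C1_differentiable_on_eq vector_derivative_works\<close>)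
qed

lemma geodesic_dist_eq:
  "geodesic_dist P x y = Inf {L. \<exists>g. curve_length P g 0 1 L \<and> g 0 = x \<and> g 1 = y}"
  unfolding geodesic_dist_def curve_length_iff_path pathstart_def pathfinish_def
  by (rule arg_cong[where f = Inf]) auto

lemma curve_length_smooth:
  assumes P: "riemannian_metric P" and "a \<le> b"
    and der: "\<And>s. s \<in> {a..b} \<Longrightarrow> (g has_vector_derivative g' s) (at s)"
    and cont: "continuous_on {a..b} g'"
  shows "curve_length P g a b (integral {a..b} (\<lambda>s. metric_norm P (g s) (g' s)))"
proof -
  have g: "continuous_on {a..b} g"
    using der by (meson continuous_at_imp_continuous_on has_vector_derivative_continuous)
  show ?thesis
    by (rule curve_lengthI[where S = "{}" and g' = g'])
       (use assms g in \<open>auto intro!: integrable_integral integrable_continuous_real continuous_on_metric_norm\<close>)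
qed

text \<open>Segments make the set of competing lengths nonempty and give upper bounds for distances.
  The quantifier over \<open>B\<close> is inside, so that one \<open>L\<close> serves all
  bounds.\<close>

lemma curve_length_line:
  assumes "riemannian_metric P"
  shows "\<exists>L. curve_length P (linepath x y) 0 1 L \<and>
     (\<forall>B. (\<forall>s\<in>{0..1}. metric_norm P (linepath x y s) (y - x) \<le> B) \<longrightarrow> L \<le> B)"
proof -
  have d: "(linepath x y has_vector_derivative y - x) (at s)" for s
    by (rule has_vector_derivative_linepath_within)
  have "continuous_on {0..1} (\<lambda>s. metric_norm P (linepath x y s) (y - x))"
    by (intro continuous_on_metric_norm assms continuous_intros)
  then have int: "(\<lambda>s. metric_norm P (linepath x y s) (y - x)) integrable_on {0..1}"
    by (rule integrable_continuous_real)
  have "integral {0..1} (\<lambda>s. metric_norm P (linepath x y s) (y - x)) \<le> B"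
    if "\<forall>s\<in>{0..1}. metric_norm P (linepath x y s) (y - x) \<le> B" for B
    using integral_le[OF int integrable_const_ivl, of B] that by simp
  with curve_length_smooth[OF assms zero_le_one d] show ?thesis by force
qed

lemma geodesic_dist_le:
  assumes P: "riemannian_metric P" and g: "curve_length P g a b L" and ab: "a < b"
  shows "geodesic_dist P (g a) (g b) \<le> L"
proof -
  have "(\<lambda>s. (b - a) * s + a) ` {0..1} = {a..b}"
    using ab by (simp add: image_affinity_atLeastAtMost)
  then have "curve_length P (\<lambda>s. g ((b - a) * s + a)) 0 1 L"
    using curve_length_affine[OF g] ab by simp
  then have "L \<in> {L. \<exists>k. curve_length P k 0 1 L \<and> k 0 = g a \<and> k 1 = g b}"
    by force
  then show ?thesis
    unfolding geodesic_dist_eq using curve_length_nonneg[OF P]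
    by (intro cInf_lower bdd_belowI[of _ 0]) auto
qed

lemma geodesic_dist_less_curve:
  assumes P: "riemannian_metric P" and "geodesic_dist P x y < r"
  obtains g L where "curve_length P g 0 1 L" "g 0 = x" "g 1 = y" "L < r"
proof -
  have ne: "{L. \<exists>g. curve_length P g 0 1 L \<and> g 0 = x \<and> g 1 = y} \<noteq> {}"
  proof -
    obtain L where "curve_length P (linepath x y) 0 1 L"
      using curve_length_line[OF P] by blast
    then have "L \<in> {L. \<exists>g. curve_length P g 0 1 L \<and> g 0 = x \<and> g 1 = y}"
      by (auto intro!: exI[of _ "linepath x y"] simp: linepath_0' linepath_1')
    then show ?thesis by blast
  qed
  from cInf_lessD[OF ne assms(2)[unfolded geodesic_dist_eq]]
  show ?thesis using that by blast
qed

text \<open>The chord is the integral of \<open>g'\<close>, hence no longer than the integral of its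
  norm, which is at most \<open>L / m\<close>.\<close>

lemma curve_length_ge_norm:
  assumes g: "curve_length P g a b L"
    and m: "\<And>s v. s \<in> {a..b} \<Longrightarrow> m * norm v \<le> metric_norm P (g s) v" "0 < m"
  shows "m * norm (g b - g a) \<le> L"
proof -
  obtain S g' where G: "a \<le> b" "continuous_on {a..b} g" "finite S"
    "\<And>s. s \<in> {a..b} - S \<Longrightarrow> (g has_vector_derivative g' s) (at s)"
    "continuous_on ({a..b} - S) g'"
    "((\<lambda>s. metric_norm P (g s) (g' s)) has_integral L) {a..b}"
    using curve_lengthE[OF g] by metis
  have ftc: "(g' has_integral (g b - g a)) {a..b}"
    by (rule fundamental_theorem_of_calculus_strong[OF G(3,1) _ G(2)]) (use G(4) in auto)
  have "((\<lambda>s. (1/m) * metric_norm P (g s) (g' s)) has_integral (1/m) * L) {a..b}"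
    using has_integral_mult_right[OF G(6)] .
  then have "norm (integral {a..b} g') \<le> integral {a..b} (\<lambda>s. (1/m) * metric_norm P (g s) (g' s))"
    using ftc m by (intro integral_norm_bound_integral) (auto simp: integrable_on_def field_simps)
  also have "\<dots> = (1/m) * L" using G(6) by (auto intro: integral_unique)
  finally show ?thesis using ftc m(2) by (simp add: integral_unique field_simps)
qed

text \<open>The constant \<open>m\<close> is only valid in the ball of radius \<open>r\<close>. A
  curve that stays inside pays at least \<open>m * norm (y - p)\<close>; a curve that leaves has
  already paid \<open>m * r\<close> when it first reaches the sphere. Hence the minimum.\<close>

lemma geodesic_dist_ge_norm:
  assumes P: "riemannian_metric P" and r: "0 < r"
    and m: "\<And>x v. x \<in> cball p r \<Longrightarrow> m * norm v \<le> metric_norm P x v" "0 < m"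
  shows "m * min r (norm (y - p)) \<le> geodesic_dist P p y"
proof (rule ccontr)
  assume "\<not> ?thesis"
  then obtain g L where g: "curve_length P g 0 1 L" "g 0 = p" "g 1 = y"
    and L: "L < m * min r (norm (y - p))"
    by (metis geodesic_dist_less_curve[OF P] not_le)
  have cont: "continuous_on {0..1} g" using g(1) by (rule curve_lengthE)
  \<comment> \<open>The time at which the curve is cut: its end if it never reaches the sphere,
    otherwise the least time on the sphere. A point outside before \<open>t\<close> would force an
    earlier crossing.\<close>
  obtain t where t: "t \<in> {0..1}" "norm (g t - p) \<ge> min r (norm (y - p))"
    and in_ball: "\<And>s. s \<in> {0..t} \<Longrightarrow> norm (g s - p) \<le> r"
  proof (cases "\<forall>s\<in>{0..1}. norm (g s - p) < r")
    case True
    then show ?thesis using that[of 1] g by (force intro: less_imp_le)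
  next
    case False
    define Z where "Z = {s \<in> {0..1}. norm (g s - p) = r}"
    have "compact Z"
    proof -
      have "closed Z" unfolding Z_def
        by (intro continuous_closed_preimage_constant[of "{0..1}" "\<lambda>s. norm (g s - p)"]
            continuous_intros cont)
      then show ?thesis
        by (rule compact_Int_closed[of "{0..1}", OF compact_Icc, THEN back_subst[of compact]]) (auto simp: Z_def)
    qed
    obtain s where s: "s \<in> {0..1}" "norm (g s - p) \<ge> r" using False by force
    have "\<exists>u\<ge>0. u \<le> s \<and> norm (g u - p) = r"
      by (rule IVT') (use s g r in \<open>auto intro!: continuous_intros continuous_on_subset[OF cont]\<close>)
    then obtain u where "0 \<le> u" "u \<le> s" "norm (g u - p) = r" by blast
    then have "u \<in> Z" using s by (simp add: Z_def)
    then have "Z \<noteq> {}" by blast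
    then obtain t where t: "t \<in> Z" "\<And>s. s \<in> Z \<Longrightarrow> t \<le> s"
      using compact_attains_inf[OF \<open>compact Z\<close>] by blast
    show ?thesis
    proof (rule that[of t])
      show "t \<in> {0..1}" "min r (norm (y - p)) \<le> norm (g t - p)" using t by (auto simp: Z_def)
      fix s assume s: "s \<in> {0..t}"
      show "norm (g s - p) \<le> r"
      proof (rule ccontr)
        assume "\<not> norm (g s - p) \<le> r"
        then have "\<exists>u\<ge>0. u \<le> s \<and> norm (g u - p) = r"
          by (intro IVT') (use s t g r in \<open>auto simp: Z_def intro!: continuous_intros continuous_on_subset[OF cont]\<close>)
        then obtain u where u: "0 \<le> u" "u \<le> s" "norm (g u - p) = r" by blast
        then have "u \<in> Z" using s t by (auto simp: Z_def)
        then have "u = s" using t s u by force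
        then show False using u \<open>\<not> norm (g s - p) \<le> r\<close> by simp
      qed
    qed
  qed
  obtain len where len: "curve_length P g 0 t (len t)" "curve_length P g t 1 (L - len t)"
    using curve_length_split[OF g(1)] t(1) by metis
  have "m * norm (g t - g 0) \<le> len t"
    by (rule curve_length_ge_norm[OF len(1) m(1) m(2)])
       (use in_ball in \<open>auto simp: dist_norm norm_minus_commute\<close>)
  moreover have "0 \<le> L - len t" using curve_length_nonneg[OF P len(2)] .
  moreover have "m * min r (norm (y - p)) \<le> m * norm (g t - p)"
    using t(2) m(2) by simp
  ultimately show False using L g(2) by simp
qed

text \<open>Integrability of the image speed is the point that needs proof, since the speed may be
  unbounded near \<open>S\<close>. Off \<open>S\<close> it is continuous, hence measurable, and it
  is dominated by \<open>k\<close> times the integrable speed of \<open>g\<close>.\<close>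

lemma curve_length_image:
  assumes P: "riemannian_metric P" and g: "curve_length P g a b L"
    and E: "C1 E" and k: "\<And>s v. s \<in> {a..b} \<Longrightarrow>
      metric_norm P (E (g s)) (frechet_derivative E (at (g s)) v) \<le> k * metric_norm P (g s) v"
  obtains L' where "curve_length P (\<lambda>s. E (g s)) a b L'" "L' \<le> k * L"
proof -
  obtain S g' where G: "a \<le> b" "continuous_on {a..b} g" "finite S"
    "\<And>s. s \<in> {a..b} - S \<Longrightarrow> (g has_vector_derivative g' s) (at s)"
    "continuous_on ({a..b} - S) g'"
    "((\<lambda>s. metric_norm P (g s) (g' s)) has_integral L) {a..b}"
    using curve_lengthE[OF g] by metis
  define f where "f = (\<lambda>s. metric_norm P (E (g s)) (frechet_derivative E (at (g s)) (g' s)))"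
  have gS: "continuous_on ({a..b} - S) g" by (rule continuous_on_subset[OF G(2)]) auto
  have E': "continuous_on ({a..b} - S) (\<lambda>s. frechet_derivative E (at (g s)) (g' s))"
    by (rule continuous_on_C1_derivative[OF E gS G(5)])
  have "continuous_on ({a..b} - S) f"
    unfolding f_def
    by (intro continuous_on_metric_norm[OF P _ E'] continuous_on_compose2[OF C1_continuous_on[OF E] gS]) auto
  moreover have sets: "{a..b} - S \<in> sets lebesgue"
    using G(3) by (intro sets.Diff) (auto simp: finite_imp_closed)
  ultimately have meas: "f \<in> borel_measurable (lebesgue_on ({a..b} - S))"
    by (rule continuous_imp_measurable_on_sets_lebesgue)
  have kint: "((\<lambda>s. k * metric_norm P (g s) (g' s)) has_integral k * L) {a..b}"
    by (rule has_integral_mult_right[OF G(6)])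
  then have "(\<lambda>s. k * metric_norm P (g s) (g' s)) integrable_on ({a..b} - S)"
    by (rule integrable_spike_set[OF has_integral_integrable])
       (use G(3) in \<open>auto intro: negligible_subset[OF negligible_finite]\<close>)
  then have "f integrable_on ({a..b} - S)"
  proof (rule measurable_bounded_by_integrable_imp_integrable_real[OF meas _ _ sets])
    show "\<bar>f s\<bar> \<le> k * metric_norm P (g s) (g' s)" if "s \<in> {a..b} - S" for s
      using k[of s "g' s"] that metric_norm_nonneg[OF P] by (simp add: f_def)
  qed
  then have fint: "f integrable_on {a..b}"
    by (rule integrable_spike_set) (use G(3) in \<open>auto intro: negligible_subset[OF negligible_finite]\<close>)
  show ?thesis
  proof (rule that)
    show "curve_length P (\<lambda>s. E (g s)) a b (integral {a..b} f)"
    proof (rule curve_lengthI[OF G(1) _ G(3)])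
      show "continuous_on {a..b} (\<lambda>s. E (g s))"
        by (intro continuous_on_compose2[OF C1_continuous_on[OF E] G(2)]) auto
      show "((\<lambda>s. E (g s)) has_vector_derivative frechet_derivative E (at (g s)) (g' s)) (at s)"
        if "s \<in> {a..b} - S" for s
        using vector_derivative_diff_chain_within[of g "g' s" s UNIV E "frechet_derivative E (at (g s))"]
          G(4)[OF that] has_derivative_at_withinI[OF C1_has_derivative[OF E]] by (simp add: o_def)
      show "((\<lambda>s. metric_norm P (E (g s)) (frechet_derivative E (at (g s)) (g' s))) has_integral integral {a..b} f) {a..b}"
        using integrable_integral[OF fint] by (simp add: f_def)
    qed (rule E')
    show "integral {a..b} f \<le> k * L"
      by (rule has_integral_le[OF integrable_integral[OF fint] kint]) (simp add: f_def k)
  qed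
qed

section \<open>The geodesic distance\<close>

lemma geodesic_dist_nonneg: "riemannian_metric P \<Longrightarrow> 0 \<le> geodesic_dist P x y"
  by (meson curve_length_nonneg geodesic_dist_less_curve less_le_trans not_le)

lemma geodesic_dist_refl:
  assumes "riemannian_metric P" shows "geodesic_dist P x x = 0"
proof -
  obtain L where L: "curve_length P (linepath x x) 0 1 L" "L \<le> 0"
    using curve_length_line[OF assms, of x x] by (auto simp: metric_norm_def)
  show ?thesis
    using geodesic_dist_le[OF assms L(1)] L(2) geodesic_dist_nonneg[OF assms, of x x]
    by (simp add: linepath_0' linepath_1')
qed

lemma geodesic_dist_le_length:
  assumes P: "riemannian_metric P" and g: "curve_length P g a b L"
  shows "geodesic_dist P (g a) (g b) \<le> L"
proof (cases "a < b")
  case False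
  then have "a = b" using curve_lengthE[OF g] by fastforce
  then show ?thesis using geodesic_dist_refl[OF P] curve_length_nonneg[OF P g] by simp
qed (rule geodesic_dist_le[OF P g])

lemma geodesic_dist_le_norm:
  assumes P: "riemannian_metric P" and K: "convex K" "x \<in> K" "y \<in> K"
    and B: "\<And>z v. z \<in> K \<Longrightarrow> metric_norm P z v \<le> B * norm v"
  shows "geodesic_dist P x y \<le> B * norm (y - x)"
proof -
  obtain L where L: "curve_length P (linepath x y) 0 1 L"
    "(\<forall>s\<in>{0..1}. metric_norm P (linepath x y s) (y - x) \<le> B * norm (y - x)) \<longrightarrow> L \<le> B * norm (y - x)"
    using curve_length_line[OF P, of x y] by blast
  have "linepath x y s \<in> K" if "s \<in> {0..1}" for s
    using that K by (meson closed_segment_subset linepath_in_path subsetD)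
  then have "L \<le> B * norm (y - x)" using L(2) B by blast
  with geodesic_dist_le_length[OF P L(1)] show ?thesis by (simp add: linepath_0' linepath_1')
qed

lemma geodesic_dist_commute:
  assumes P: "riemannian_metric P" shows "geodesic_dist P x y = geodesic_dist P y x"
proof -
  have "geodesic_dist P y x \<le> geodesic_dist P x y" for x y
  proof (rule field_le_epsilon)
    fix e :: real assume "0 < e"
    then obtain g L where g: "curve_length P g 0 1 L" "g 0 = x" "g 1 = y" "L < geodesic_dist P x y + e"
      using geodesic_dist_less_curve[OF P, of x y "geodesic_dist P x y + e"] by auto
    show "geodesic_dist P y x \<le> geodesic_dist P x y + e"
      using geodesic_dist_le_length[OF P curve_length_reverse[OF g(1)]] g by simp
  qed
  then show ?thesis by (simp add: antisym)
qed

lemma geodesic_dist_triangle: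
  assumes P: "riemannian_metric P"
  shows "geodesic_dist P x z \<le> geodesic_dist P x y + geodesic_dist P y z"
proof (rule field_le_epsilon)
  fix e :: real assume e: "0 < e"
  obtain g L where g: "curve_length P g 0 1 L" "g 0 = x" "g 1 = y" "L < geodesic_dist P x y + e/2"
    using geodesic_dist_less_curve[OF P, of x y "geodesic_dist P x y + e/2"] e by auto
  obtain k L' where k: "curve_length P k 0 1 L'" "k 0 = y" "k 1 = z" "L' < geodesic_dist P y z + e/2"
    using geodesic_dist_less_curve[OF P, of y z "geodesic_dist P y z + e/2"] e by auto
  have "(\<lambda>s::real. 1 * s + -1) ` {1..2} = {0..1}"
    by (simp add: image_affinity_atLeastAtMost)
  then have k': "curve_length P (\<lambda>s. k (s - 1)) 1 2 L'"
    using curve_length_affine[OF k(1), of 1 "-1"] by simp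
  from geodesic_dist_le_length[OF P curve_length_join[OF g(1) k']]
  show "geodesic_dist P x z \<le> geodesic_dist P x y + geodesic_dist P y z + e"
    using g k by simp
qed

text \<open>Together with \<open>norm_imp_geodesic_dist_less\<close> this says that the geodesic
  distance induces the Euclidean topology. Here \<open>m * r\<close> serves as radius, because
  \<open>min r (norm (y - p)) < r\<close> forces the norm below \<open>r\<close>.\<close>

lemma geodesic_dist_imp_norm_less:
  assumes P: "riemannian_metric P" and r: "0 < r"
  obtains \<rho> where "0 < \<rho>" "\<And>y. geodesic_dist P p y < \<rho> \<Longrightarrow> norm (y - p) < r"
proof -
  obtain m B where m: "0 < m" "\<And>x v. x \<in> cball p r \<Longrightarrow> m * norm v \<le> metric_norm P x v"
    using metric_norm_compact_bounds[OF P compact_cball] by metis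
  have "norm (y - p) < r" if "geodesic_dist P p y < m * r" for y
  proof -
    have "m * min r (norm (y - p)) < m * r"
      using geodesic_dist_ge_norm[OF P r m(2,1), where y = y and p = p] that by force
    then show ?thesis using m(1) by (auto simp: min_def split: if_splits)
  qed
  then show ?thesis using that[of "m * r"] m r by simp
qed

lemma norm_imp_geodesic_dist_less:
  assumes P: "riemannian_metric P" and r: "0 < r"
  obtains \<rho> where "0 < \<rho>" "\<And>y. norm (y - p) < \<rho> \<Longrightarrow> geodesic_dist P p y < r"
proof -
  obtain m B where B: "0 < B" "\<And>x v. x \<in> cball p 1 \<Longrightarrow> metric_norm P x v \<le> B * norm v"
    using metric_norm_compact_bounds[OF P compact_cball] by metis
  have "geodesic_dist P p y < r" if "norm (y - p) < min 1 (r / B)" for y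
  proof -
    have "geodesic_dist P p y \<le> B * norm (y - p)"
      by (rule geodesic_dist_le_norm[OF P convex_cball _ _ B(2)])
         (use that in \<open>auto simp: dist_norm norm_minus_commute\<close>)
    also have "\<dots> < r" using that B(1) by (simp add: field_simps)
    finally show ?thesis .
  qed
  then show ?thesis using that[of "min 1 (r / B)"] B r by simp
qed

lemma Metric_space_geodesic_dist:
  assumes P: "riemannian_metric P"
  shows "Metric_space UNIV (geodesic_dist P)"
proof
  show "(geodesic_dist P x y = 0) = (x = y)" for x y
  proof
    assume 0: "geodesic_dist P x y = 0"
    show "x = y"
    proof (rule ccontr)
      assume "x \<noteq> y"
      then obtain \<rho> where "0 < \<rho>" "\<And>z. geodesic_dist P x z < \<rho> \<Longrightarrow> norm (z - x) < norm (y - x)"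
        using geodesic_dist_imp_norm_less[OF P, of "norm (y - x)" x] by auto
      then show False using 0 by force
    qed
  qed (simp add: geodesic_dist_refl[OF P])
qed (use geodesic_dist_nonneg[OF P] geodesic_dist_commute[OF P] geodesic_dist_triangle[OF P] in \<open>blast+\<close>)

lemma geodesic_dist_between:
  assumes P: "riemannian_metric P" and less: "geodesic_dist P x y < a + b" and "0 < a" "0 < b"
  obtains z where "geodesic_dist P x z < a" "geodesic_dist P z y < b"
proof -
  obtain g L where g: "curve_length P g 0 1 L" "g 0 = x" "g 1 = y" "L < a + b"
    using geodesic_dist_less_curve[OF P less] by blast
  obtain len where len: "continuous_on {0..1} len" "len 0 = 0" "len 1 = L"
    "\<And>s. s \<in> {0..1} \<Longrightarrow> curve_length P g 0 s (len s)"
    "\<And>s. s \<in> {0..1} \<Longrightarrow> curve_length P g s 1 (L - len s)"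
    using curve_length_split[OF g(1)] by metis
  have L0: "0 \<le> L" using curve_length_nonneg[OF P g(1)] .
  \<comment> \<open>The cut length has to satisfy \<open>L - b < c < a\<close>: the midpoint of
    these two bounds, clamped to the range from 0 to \<open>L\<close> of arc length.\<close>
  define c where "c = max 0 (min L ((L - b + a) / 2))"
  have c: "0 \<le> c" "c \<le> L" "c < a" "L - c < b"
    using g(4) L0 assms(3,4) by (auto simp: c_def max_def min_def field_simps)
  obtain s where s: "s \<in> {0..1}" "len s = c"
    using IVT'[of len 0 c 1] len c by auto
  show ?thesis
    using that[of "g s"] geodesic_dist_le_length[OF P len(4)[OF s(1)]]
      geodesic_dist_le_length[OF P len(5)[OF s(1)]] g s(2) c by simp
qed

section \<open>Boundedness of balls, after Hopf and Rinow\<close>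

lemma open_geodesic_ball:
  assumes P: "riemannian_metric P"
  shows "open {y. geodesic_dist P p y < r}"
proof (rule openI)
  fix x assume x: "x \<in> {y. geodesic_dist P p y < r}"
  obtain \<rho> where \<rho>: "0 < \<rho>" "\<And>y. norm (y - x) < \<rho> \<Longrightarrow> geodesic_dist P x y < r - geodesic_dist P p x"
    using norm_imp_geodesic_dist_less[OF P, of "r - geodesic_dist P p x" x] x by auto
  have "ball x \<rho> \<subseteq> {y. geodesic_dist P p y < r}"
  proof
    fix y assume "y \<in> ball x \<rho>"
    then have "geodesic_dist P x y < r - geodesic_dist P p x"
      by (intro \<rho>(2)) (simp add: dist_norm norm_minus_commute)
    then show "y \<in> {y. geodesic_dist P p y < r}"
      using geodesic_dist_triangle[OF P, of p y x] by simp
  qed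
  then show "\<exists>T>0. ball x T \<subseteq> {y. geodesic_dist P p y < r}" using \<rho>(1) by blast
qed

text \<open>Since the metric is intrinsic, a ball grows by \<open>r / 8\<close> inside finitely many balls of radius
  \<open>r / 4\<close> centred in it.\<close>

lemma bounded_geodesic_ball_step:
  assumes P: "riemannian_metric P" and r: "0 < r"
    and small: "\<And>z. geodesic_dist P p z < r \<Longrightarrow> bounded {y. geodesic_dist P z y < r / 2}"
  shows "bounded {y. geodesic_dist P p y < r}"
proof -
  let ?B = "\<lambda>k. {y. geodesic_dist P p y < real k * (r / 8)}"
  have "bounded (?B k)" if "k \<le> 8" for k
    using that
  proof (induction k)
    case 0
    have "?B 0 = {}" using geodesic_dist_nonneg[OF P] by (force simp: not_less)
    then show ?case by (metis bounded_empty)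
  next
    case (Suc k)
    show ?case
    \<comment> \<open>\<open>?B 0\<close> is empty and offers no centres, and
      \<open>geodesic_dist_between\<close> needs a positive first radius; so the first ball is taken
      from the hypothesis at \<open>p\<close> itself.\<close>
    proof (cases "k = 0")
      case True
      have "bounded {y. geodesic_dist P p y < r / 2}"
        using small[of p] r geodesic_dist_refl[OF P] by simp
      then show ?thesis by (rule bounded_subset) (use True r in auto)
    next
      case False
      have "compact (closure (?B k))"
        using Suc by (simp add: compact_closure)
      moreover have "closure (?B k) \<subseteq> (\<Union>w\<in>?B k. {z. geodesic_dist P w z < r / 8})"
      proof
        fix z assume z: "z \<in> closure (?B k)"
        obtain \<rho> where "0 < \<rho>" "\<And>y. norm (y - z) < \<rho> \<Longrightarrow> geodesic_dist P z y < r / 8"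
          using norm_imp_geodesic_dist_less[OF P, of "r / 8" z] r by auto
        moreover obtain w where "w \<in> ?B k" "norm (w - z) < \<rho>"
          using z \<open>0 < \<rho>\<close> by (auto simp: closure_approachable dist_norm)
        ultimately show "z \<in> (\<Union>w\<in>?B k. {z. geodesic_dist P w z < r / 8})"
          using geodesic_dist_commute[OF P] by force
      qed
      ultimately obtain W where W: "W \<subseteq> ?B k" "finite W"
        "closure (?B k) \<subseteq> (\<Union>w\<in>W. {z. geodesic_dist P w z < r / 8})"
        using compactE_image[of "closure (?B k)" "?B k" "\<lambda>w. {z. geodesic_dist P w z < r / 8}"]
          open_geodesic_ball[OF P] by metis
      have "?B (Suc k) \<subseteq> (\<Union>w\<in>W. {y. geodesic_dist P w y < r / 2})"
      proof
        fix y assume "y \<in> ?B (Suc k)"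
        then have "geodesic_dist P p y < real k * (r / 8) + r / 8"
          by (simp add: algebra_simps)
        then obtain z where z: "geodesic_dist P p z < real k * (r / 8)" "geodesic_dist P z y < r / 8"
          using geodesic_dist_between[OF P, of p y "real k * (r / 8)" "r / 8"] r False by auto
        then obtain w where "w \<in> W" "geodesic_dist P w z < r / 8"
          using W(3) closure_subset[of "?B k"] by blast
        then show "y \<in> (\<Union>w\<in>W. {y. geodesic_dist P w y < r / 2})"
          using z(2) geodesic_dist_triangle[OF P, of w y z] r by force
      qed
      moreover have "geodesic_dist P p w < r" if "w \<in> W" for w
      proof -
        have "real k * (r / 8) \<le> 8 * (r / 8)"
          using Suc.prems r by (intro mult_right_mono) auto
        then show ?thesis using that W(1) by force
      qed
      ultimately show ?thesis
        using W(2) small by (meson bounded_UN bounded_subset)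
    qed
  qed
  from this[of 8] show ?thesis by simp
qed

lemma complete_metric_limit:
  fixes \<sigma> :: "nat \<Rightarrow> real^'n"
  assumes P: "riemannian_metric P" and complete: "complete_metric P"
    and cauchy: "\<And>e. 0 < e \<Longrightarrow> \<exists>N. \<forall>m\<ge>N. \<forall>n\<ge>m. geodesic_dist P (\<sigma> m) (\<sigma> n) < e"
  obtains q where "\<And>e. 0 < e \<Longrightarrow> \<exists>N. \<forall>n\<ge>N. geodesic_dist P (\<sigma> n) q < e"
proof -
  interpret Metric_space UNIV "geodesic_dist P"
    by (rule Metric_space_geodesic_dist[OF P])
  have "MCauchy \<sigma>"
    unfolding MCauchy_def
  proof (intro conjI allI impI)
    fix e :: real assume "0 < e"
    then obtain N where "\<forall>m\<ge>N. \<forall>n\<ge>m. geodesic_dist P (\<sigma> m) (\<sigma> n) < e"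
      using cauchy by blast
    then show "\<exists>N. \<forall>m n. N \<le> m \<longrightarrow> N \<le> n \<longrightarrow> geodesic_dist P (\<sigma> m) (\<sigma> n) < e"
      by (metis commute nle_le)
  qed simp
  then obtain q where "limitin mtopology \<sigma> q sequentially"
    using complete by (auto simp: complete_metric_def mcomplete_def)
  then show ?thesis
    using that by (auto simp: limit_metric_sequentially)
qed

text \<open>By the previous step, an unbounded ball of radius \<open>r\<close> contains the centre
  of an unbounded ball of half the radius. Iterating gives a Cauchy sequence of centres. Near its
  limit \<open>q\<close> small geodesic balls are bounded, yet they contain the late unbounded
  balls.\<close>

lemma bounded_geodesic_ball:
  assumes P: "riemannian_metric P" and complete: "complete_metric P"
  shows "bounded {y. geodesic_dist P p y < r}"
proof (rule ccontr)
  assume unb: "\<not> ?thesis"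
  have r: "0 < r"
  proof (rule ccontr)
    assume "\<not> 0 < r"
    then have "{y. geodesic_dist P p y < r} = {}"
      using geodesic_dist_nonneg[OF P] by (force simp: not_less intro: order_trans)
    then show False using unb by simp
  qed
  have "\<exists>\<sigma>. \<forall>n. \<not> bounded {y. geodesic_dist P (\<sigma> n) y < r / 2 ^ n} \<and>
      geodesic_dist P (\<sigma> n) (\<sigma> (Suc n)) < r / 2 ^ n"
  proof (rule dependent_nat_choice)
    show "\<exists>x. \<not> bounded {y. geodesic_dist P x y < r / 2 ^ 0}" using unb by auto
    fix x n assume "\<not> bounded {y. geodesic_dist P x y < r / 2 ^ n}"
    then show "\<exists>z. \<not> bounded {y. geodesic_dist P z y < r / 2 ^ Suc n} \<and> geodesic_dist P x z < r / 2 ^ n"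
      using bounded_geodesic_ball_step[OF P, of "r / 2 ^ n" x] r by (force simp: field_simps)
  qed
  then obtain \<sigma> where unb': "\<And>n. \<not> bounded {y. geodesic_dist P (\<sigma> n) y < r / 2 ^ n}"
    and step: "\<And>n. geodesic_dist P (\<sigma> n) (\<sigma> (Suc n)) < r / 2 ^ n"
    by blast
  \<comment> \<open>Partial sums of the geometric series of the steps
    \<open>r / 2 ^ n\<close>.\<close>
  have tele: "geodesic_dist P (\<sigma> n) (\<sigma> (n + k)) \<le> 2 * r / 2 ^ n - 2 * r / 2 ^ (n + k)" for n k
  proof (induction k)
    case 0
    then show ?case by (simp add: geodesic_dist_refl[OF P])
  next
    case (Suc k)
    have "geodesic_dist P (\<sigma> n) (\<sigma> (n + Suc k)) \<le>
        geodesic_dist P (\<sigma> n) (\<sigma> (n + k)) + geodesic_dist P (\<sigma> (n + k)) (\<sigma> (Suc (n + k)))"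
      using geodesic_dist_triangle[OF P] by simp
    also have "\<dots> \<le> 2 * r / 2 ^ n - 2 * r / 2 ^ (n + k) + r / 2 ^ (n + k)"
      using Suc step[of "n + k"] by linarith
    also have "\<dots> = 2 * r / 2 ^ n - 2 * r / 2 ^ (n + Suc k)"
      by (simp add: field_simps)
    finally show ?case .
  qed
  have small: "\<exists>N. \<forall>n\<ge>N. 2 * r / 2 ^ n < e" if "0 < e" for e :: real
  proof -
    have "(\<lambda>n. 2 * r / 2 ^ n) \<longlonglongrightarrow> (0::real)"
      by (intro LIMSEQ_divide_realpow_zero) auto
    from order_tendstoD(2)[OF this that] show ?thesis by (simp add: eventually_sequentially)
  qed
  obtain q where q: "\<And>e. 0 < e \<Longrightarrow> \<exists>N. \<forall>n\<ge>N. geodesic_dist P (\<sigma> n) q < e"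
  proof (rule complete_metric_limit[OF P complete])
    fix e :: real assume "0 < e"
    then obtain N where N: "\<forall>n\<ge>N. 2 * r / 2 ^ n < e" using small by blast
    have "geodesic_dist P (\<sigma> m) (\<sigma> n) < e" if "N \<le> m" "m \<le> n" for m n
    proof -
      have "0 \<le> 2 * r / 2 ^ n" using r by simp
      then show ?thesis using tele[of m "n - m"] N that by force
    qed
    then show "\<exists>N. \<forall>m\<ge>N. \<forall>n\<ge>m. geodesic_dist P (\<sigma> m) (\<sigma> n) < e" by blast
  qed blast
  obtain \<rho> where \<rho>: "0 < \<rho>" "\<And>y. geodesic_dist P q y < \<rho> \<Longrightarrow> norm (y - q) < 1"
    using geodesic_dist_imp_norm_less[OF P zero_less_one, of q] by blast
  obtain N1 where N1: "\<forall>n\<ge>N1. geodesic_dist P (\<sigma> n) q < \<rho> / 2" using q[of "\<rho> / 2"] \<rho> by auto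
  obtain N2 where N2: "\<forall>n\<ge>N2. 2 * r / 2 ^ n < \<rho> / 2" using small[of "\<rho> / 2"] \<rho> by auto
  define n where "n = max N1 N2"
  \<comment> \<open>For this \<open>n\<close> both the radius and the distance of the centre from
    \<open>q\<close> are below \<open>\<rho> / 2\<close>.\<close>
  have "{y. geodesic_dist P (\<sigma> n) y < r / 2 ^ n} \<subseteq> cball q 1"
  proof
    fix y assume "y \<in> {y. geodesic_dist P (\<sigma> n) y < r / 2 ^ n}"
    moreover have "0 \<le> r / 2 ^ n" "2 * r / 2 ^ n < \<rho> / 2" using r N2 by (auto simp: n_def)
    moreover have "geodesic_dist P q (\<sigma> n) < \<rho> / 2"
      using N1 geodesic_dist_commute[OF P] by (simp add: n_def)
    ultimately have "geodesic_dist P q y < \<rho>"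
      using geodesic_dist_triangle[OF P, of q y "\<sigma> n"] by simp
    then show "y \<in> cball q 1" using \<rho>(2) by (force simp: dist_norm norm_minus_commute)
  qed
  then show False using unb' bounded_cball bounded_subset by blast
qed

section \<open>Solutions of ordinary differential equations\<close>

text \<open>The sum of the norms of the basis derivatives bounds the operator norm and is bounded on
  the compact ball; convexity of the ball then gives the Lipschitz constant.\<close>

lemma C1_lipschitz_cball:
  fixes g :: "'a::euclidean_space \<Rightarrow> 'b::real_normed_vector"
  assumes g: "C1 g"
  obtains L where "0 < L" "L-lipschitz_on (cball z R) g"
proof -
  let ?n = "\<lambda>x. \<Sum>b\<in>Basis. norm (frechet_derivative g (at x) b)"
  have "continuous_on (cball z R) ?n"
    by (intro continuous_intros continuous_on_C1_derivative g)
  then have "bounded (?n ` cball z R)"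
    by (intro compact_imp_bounded compact_continuous_image compact_cball)
  then obtain C where C: "0 < C" "\<And>x. x \<in> cball z R \<Longrightarrow> ?n x \<le> C"
    unfolding bounded_pos by force
  have "C-lipschitz_on (cball z R) g"
  proof (rule bounded_derivative_imp_lipschitz)
    show "(g has_derivative frechet_derivative g (at x)) (at x within cball z R)" for x
      by (rule has_derivative_at_withinI[OF C1_has_derivative[OF g]])
    fix x assume x: "x \<in> cball z R"
    show "onorm (frechet_derivative g (at x)) \<le> C"
    proof (rule onorm_le)
      fix v
      have "norm (frechet_derivative g (at x) v) \<le> (\<Sum>b\<in>Basis. norm ((v \<bullet> b) *\<^sub>R frechet_derivative g (at x) b))"
        by (subst C1_derivative_expansion[OF g]) (rule norm_sum)
      also have "\<dots> \<le> (\<Sum>b\<in>Basis. norm v * norm (frechet_derivative g (at x) b))"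
        by (intro sum_mono) (auto intro!: mult_right_mono Basis_le_norm)
      also have "\<dots> = ?n x * norm v" by (simp add: sum_distrib_left mult.commute)
      also have "\<dots> \<le> C * norm v" using C(2)[OF x] by (intro mult_right_mono) auto
      finally show "norm (frechet_derivative g (at x) v) \<le> C * norm v" .
    qed
  qed (use C in auto)
  then show ?thesis using that C(1) by blast
qed

lemma at_within_Icc_eq_Ici:
  fixes t b :: real assumes "t < b" shows "at t within {a..b} = at t within {a..}"
  by (rule at_within_nhd[of _ "{..<b}"]) (use assms in auto)

lemma indefinite_integral_has_vector_derivative_Ici:
  fixes v :: "real \<Rightarrow> 'a::banach"
  assumes v: "continuous_on {0..} v" and t: "0 \<le> t"
  shows "((\<lambda>t. integral {0..t} v) has_vector_derivative v t) (at t within {0..})"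
proof -
  have "continuous_on {0..t + 1} v" by (rule continuous_on_subset[OF v]) auto
  from integral_has_vector_derivative[OF this, of t] t show ?thesis
    by (simp add: at_within_Icc_eq_Ici)
qed

text \<open>The weight \<open>exp (- 2 * L * t)\<close> makes the Picard operator a contraction on the whole half-line.\<close>

lemma global_lipschitz_ode_solution:
  fixes F :: "'a::euclidean_space \<Rightarrow> 'a"
  assumes lip: "L-lipschitz_on UNIV F" and L: "0 < L" and B: "\<And>x. norm (F x) \<le> B"
  obtains x where "x 0 = x0" "\<And>t. 0 \<le> t \<Longrightarrow> (x has_vector_derivative F (x t)) (at t within {0..})"
proof -
  \<comment> \<open>The unknown is rescaled to
    \<open>u t = exp (- 2 * L * t) *\<^sub>R (x t - x0)\<close>, so that it lies in the complete
    space of bounded continuous functions.\<close>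
  define v where "v = (\<lambda>u s. F (x0 + exp (2 * L * s) *\<^sub>R apply_bcontfun u s))"
  \<comment> \<open>Those functions live on the whole line; \<open>max 0 t\<close> extends the
    operator constantly to negative times. Boundedness of \<open>F\<close> makes the integral grow
    at most linearly, so the weighted result is bounded.\<close>
  define T where "T = (\<lambda>u t. exp (- 2 * L * max 0 t) *\<^sub>R integral {0..max 0 t} (v u))"
  have F: "continuous_on S F" for S
    using lipschitz_on_continuous_on[OF lip] continuous_on_subset by blast
  have v: "continuous_on S (v u)" for S u
    unfolding v_def by (intro continuous_on_compose2[OF F[of UNIV]] continuous_intros) auto
  have "continuous_on {0..} (\<lambda>t. integral {0..t} (v u))" for u
    unfolding continuous_on_eq_continuous_within
    using indefinite_integral_has_vector_derivative_Ici[OF v] has_vector_derivative_continuous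
    by blast
  then have contT: "continuous_on UNIV (T u)" for u
    unfolding T_def
    by (intro continuous_intros continuous_on_compose2[of "{0..}" "\<lambda>t. integral {0..t} (v u)" UNIV "max 0"]) auto
  have B0: "0 \<le> B" using B[of 0] norm_ge_zero order_trans by blast
  have bdT: "norm (T u t) \<le> B / (2 * L)" for u t
  proof -
    define \<tau> where "\<tau> = max 0 t"
    have \<tau>: "0 \<le> \<tau>" by (simp add: \<tau>_def)
    have "norm (integral {0..\<tau>} (v u)) \<le> B * (\<tau> - 0)"
      by (rule integral_bound[OF \<tau> v]) (simp add: v_def B)
    then have "exp (- 2 * L * \<tau>) * norm (integral {0..\<tau>} (v u)) \<le> exp (- 2 * L * \<tau>) * (B * \<tau>)"
      by (intro mult_left_mono) auto
    also have "\<dots> = B * (\<tau> * exp (- 2 * L * \<tau>))" by (simp only: mult_ac)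
    also have "\<dots> \<le> B * (1 / (2 * L))"
    proof (rule mult_left_mono[OF _ B0])
      have "2 * L * \<tau> \<le> exp (2 * L * \<tau>)"
        using exp_ge_add_one_self[of "2 * L * \<tau>"] by linarith
      then show "\<tau> * exp (- 2 * L * \<tau>) \<le> 1 / (2 * L)" using L by (simp add: exp_minus field_simps)
    qed
    finally show ?thesis by (simp add: T_def \<tau>_def[symmetric])
  qed
  define U where "U = (\<lambda>u. Bcontfun (T u))"
  have U: "apply_bcontfun (U u) = T u" for u
    unfolding U_def by (rule Bcontfun_inverse, rule bcontfun_normI[OF contT bdT])
  have "dist (U u) (U w) \<le> (1/2) * dist u w" for u w
  proof (rule dist_bound)
    fix t :: real
    define \<tau> where "\<tau> = max 0 t"
    define d where "d = dist u w"
    have \<tau>: "0 \<le> \<tau>" by (simp add: \<tau>_def)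
    have int: "v u integrable_on {0..\<tau>}" for u
      by (rule integrable_continuous_real[OF v])
    \<comment> \<open>The contraction factor 1/2 arises here: the Lipschitz constant
      \<open>L\<close> is divided by the exponent \<open>2 * L\<close> on integration.\<close>
    have exp_int: "((\<lambda>s. d * L * exp (2 * L * s)) has_integral (d / 2 * exp (2 * L * \<tau>) - d / 2 * exp (2 * L * 0))) {0..\<tau>}"
      by (rule fundamental_theorem_of_calculus[OF \<tau>])
         (auto intro!: derivative_eq_intros simp flip: has_real_derivative_iff_has_vector_derivative)
    have "norm (integral {0..\<tau>} (v u) - integral {0..\<tau>} (v w)) = norm (integral {0..\<tau>} (\<lambda>s. v u s - v w s))"
      by (simp add: Henstock_Kurzweil_Integration.integral_diff int)
    also have "\<dots> \<le> integral {0..\<tau>} (\<lambda>s. d * L * exp (2 * L * s))"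
    proof (rule integral_norm_bound_integral)
      show "norm (v u s - v w s) \<le> d * L * exp (2 * L * s)" for s
      proof -
        have "norm (v u s - v w s) \<le> L * norm (exp (2 * L * s) *\<^sub>R (apply_bcontfun u s - apply_bcontfun w s))"
          using lipschitz_onD[OF lip, of "x0 + exp (2 * L * s) *\<^sub>R apply_bcontfun u s" "x0 + exp (2 * L * s) *\<^sub>R apply_bcontfun w s"]
          by (simp add: v_def dist_norm scaleR_diff_right)
        also have "\<dots> \<le> L * (exp (2 * L * s) * d)"
          using dist_bounded[of u s w] L by (simp add: dist_norm d_def)
        finally show ?thesis by (simp add: mult_ac)
      qed
      show "(\<lambda>s. v u s - v w s) integrable_on {0..\<tau>}"
        by (intro Henstock_Kurzweil_Integration.integrable_diff int)
    qed (rule has_integral_integrable[OF exp_int])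
    also have "\<dots> = d / 2 * (exp (2 * L * \<tau>) - 1)"
      unfolding integral_unique[OF exp_int] by (simp add: algebra_simps)
    finally have *: "norm (integral {0..\<tau>} (v u) - integral {0..\<tau>} (v w)) \<le> d / 2 * (exp (2 * L * \<tau>) - 1)" .
    have "dist (T u t) (T w t) = exp (- 2 * L * \<tau>) * norm (integral {0..\<tau>} (v u) - integral {0..\<tau>} (v w))"
      by (simp add: T_def \<tau>_def[symmetric] dist_norm flip: scaleR_diff_right)
    also have "\<dots> \<le> exp (- 2 * L * \<tau>) * (d / 2 * (exp (2 * L * \<tau>) - 1))"
      using * by (intro mult_left_mono) auto
    also have "\<dots> = d / 2 * (1 - exp (- 2 * L * \<tau>))"
      by (simp add: algebra_simps flip: exp_add)
    also have "\<dots> \<le> d / 2 * 1"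
      by (intro mult_left_mono) (auto simp: d_def)
    finally show "dist (apply_bcontfun (U u) t) (apply_bcontfun (U w) t) \<le> (1/2) * dist u w"
      by (simp add: U d_def)
  qed
  then obtain u where "U u = u"
    using banach_fix_type[of "1/2" U] by auto
  then have u: "apply_bcontfun u t = exp (- 2 * L * t) *\<^sub>R integral {0..t} (v u)" if "0 \<le> t" for t
    using U[of u] that by (simp add: T_def max_absorb2)
  define x where "x = (\<lambda>t. x0 + exp (2 * L * t) *\<^sub>R apply_bcontfun u t)"
  have x: "x t = x0 + integral {0..t} (v u)" if "0 \<le> t" for t
    using u[OF that] by (simp add: x_def flip: exp_add)
  have vx: "v u t = F (x t)" for t by (simp add: v_def x_def)
  show ?thesis
  proof (rule that[of x])
    show "x 0 = x0" using x[of 0] by simp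
    fix t :: real assume t: "0 \<le> t"
    have "((\<lambda>t. x0 + integral {0..t} (v u)) has_vector_derivative F (x t)) (at t within {0..})"
      using indefinite_integral_has_vector_derivative_Ici[OF v t, of u]
      by (simp add: has_vector_derivative_add_const vx add.commute[of x0])
    then show "(x has_vector_derivative F (x t)) (at t within {0..})"
      by (rule has_vector_derivative_transform[rotated 2]) (use t x in auto)
  qed
qed

section \<open>Natural gradients\<close>

lemma sym_pos_def_inverse:
  assumes "sym_pos_def B"
  shows "B *v (matrix_inv B *v u) = u" and "matrix_inv B *v (B *v u) = u"
proof -
  have "B *v v \<noteq> 0" if "v \<noteq> 0" for v
    using assms that unfolding sym_pos_def_def by (metis inner_zero_right less_irrefl)
  then have "invertible B"
    by (metis invertible_left_inverse matrix_left_invertible_ker)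
  then have "B ** matrix_inv B = mat 1 \<and> matrix_inv B ** B = mat 1"
    unfolding matrix_inv_def invertible_def by (rule someI_ex)
  then show "B *v (matrix_inv B *v u) = u" and "matrix_inv B *v (B *v u) = u"
    by (simp_all add: matrix_vector_mul_assoc)
qed

text \<open>For \<open>v = matrix_inv (M y) *v u\<close>, positivity gives
  \<open>m\<^sup>2 * (norm v)\<^sup>2 \<le> v \<bullet> u\<close>, and Cauchy-Schwarz cancels one
  factor \<open>norm v\<close>. This local bound is the only estimate of the inverse needed for its
  continuity and differentiability.\<close>

lemma norm_metric_inverse_le:
  fixes M :: "real^'n \<Rightarrow> real^'n^'n"
  assumes M: "riemannian_metric M"
  obtains C where "0 < C" "\<And>y u. y \<in> cball x 1 \<Longrightarrow> norm (matrix_inv (M y) *v u) \<le> C * norm u"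
proof -
  obtain m B where m: "0 < m" "\<And>y v. y \<in> cball x 1 \<Longrightarrow> m\<^sup>2 * (norm v)\<^sup>2 \<le> v \<bullet> (M y *v v)"
    using metric_form_compact_bounds[OF M compact_cball] by metis
  have "norm (matrix_inv (M y) *v u) \<le> 1 / m\<^sup>2 * norm u" if y: "y \<in> cball x 1" for y u
  proof (cases "matrix_inv (M y) *v u = 0")
    case False
    define v where "v = matrix_inv (M y) *v u"
    have "sym_pos_def (M y)" using M by (simp add: riemannian_metric_def)
    then have "M y *v v = u" by (simp add: v_def sym_pos_def_inverse)
    then have "m\<^sup>2 * (norm v)\<^sup>2 \<le> v \<bullet> u" using m(2)[OF y, of v] by simp
    also have "\<dots> \<le> norm v * norm u" by (rule norm_cauchy_schwarz)
    finally have "norm v * (m\<^sup>2 * norm v) \<le> norm v * norm u" by (simp add: power2_eq_square mult_ac)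
    then have "m\<^sup>2 * norm v \<le> norm u" using False by (simp add: v_def)
    then show ?thesis using m(1) by (simp add: v_def field_simps)
  qed (simp add: m)
  then show ?thesis using that[of "1 / m\<^sup>2"] m(1) by simp
qed

text \<open>With \<open>w\<close> the value at \<open>s\<close>, the error
  \<open>matrix_inv (M (y r)) *v u r - w\<close> is the inverse applied to the residual
  \<open>G r = u r - M (y r) *v w\<close>. The residual tends to 0 and the inverses are locally
  bounded.\<close>

lemma continuous_on_metric_inverse:
  fixes M :: "real^'n \<Rightarrow> real^'n^'n" and u :: "'a::t2_space \<Rightarrow> real^'n"
  assumes M: "riemannian_metric M" and y: "continuous_on S y" and u: "continuous_on S u"
  shows "continuous_on S (\<lambda>s. matrix_inv (M (y s)) *v u s)"
  unfolding continuous_on_def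
proof
  fix s assume s: "s \<in> S"
  define w where "w = matrix_inv (M (y s)) *v u s"
  define G where "G = (\<lambda>r. u r - M (y r) *v w)"
  have spd: "sym_pos_def (M x)" for x using M by (simp add: riemannian_metric_def)
  obtain C where C: "0 < C" "\<And>z u. z \<in> cball (y s) 1 \<Longrightarrow> norm (matrix_inv (M z) *v u) \<le> C * norm u"
    using norm_metric_inverse_le[OF M] by metis
  have "continuous_on S G"
    unfolding G_def
    by (intro continuous_intros u continuous_on_compose2[OF riemannian_metric_continuous_on[OF M, of UNIV] y]) auto
  then have "(G \<longlongrightarrow> G s) (at s within S)" using s by (simp add: continuous_on_def)
  moreover have "G s = 0" by (simp add: G_def w_def sym_pos_def_inverse[OF spd])
  ultimately have lim: "((\<lambda>r. C * norm (G r)) \<longlongrightarrow> 0) (at s within S)"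
    by (auto intro!: tendsto_eq_intros)
  have near: "\<forall>\<^sub>F r in at s within S. dist (y r) (y s) < 1"
    using y s by (intro tendstoD) (auto simp: continuous_on_def)
  have "((\<lambda>r. matrix_inv (M (y r)) *v u r - w) \<longlongrightarrow> 0) (at s within S)"
  proof (rule Lim_null_comparison[OF _ lim])
    show "\<forall>\<^sub>F r in at s within S. norm (matrix_inv (M (y r)) *v u r - w) \<le> C * norm (G r)"
      using near
    proof eventually_elim
      case (elim r)
      have "matrix_inv (M (y r)) *v u r - w = matrix_inv (M (y r)) *v G r"
        by (simp add: G_def matrix_vector_mult_diff_distrib sym_pos_def_inverse[OF spd])
      moreover have "y r \<in> cball (y s) 1" using elim by (simp add: dist_commute)
      ultimately show ?case using C(2) by simp
    qed
  qed
  then show "((\<lambda>r. matrix_inv (M (y r)) *v u r) \<longlongrightarrow> matrix_inv (M (y s)) *v u s) (at s within S)"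
    by (simp add: w_def Lim_null[symmetric])
qed

text \<open>The residual argument of \<open>continuous_on_metric_inverse\<close>, one order higher:
  \<open>w'\<close> is chosen to solve the equation obtained by differentiating
  \<open>M y *v w = g y\<close>, so the residual \<open>G\<close> of the affine approximation has
  value and derivative 0 at \<open>x\<close>.\<close>

lemma has_derivative_metric_inverse:
  fixes M :: "real^'n \<Rightarrow> real^'n^'n"
  assumes M: "riemannian_metric M" and g: "C1 g"
  shows "((\<lambda>y. matrix_inv (M y) *v g y) has_derivative
      (\<lambda>v. matrix_inv (M x) *v (frechet_derivative g (at x) v -
         frechet_derivative M (at x) v *v (matrix_inv (M x) *v g x)))) (at x)"
proof -
  define w where "w = matrix_inv (M x) *v g x"
  define w' where "w' = (\<lambda>v. matrix_inv (M x) *v (frechet_derivative g (at x) v - frechet_derivative M (at x) v *v w))"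
  define G where "G = (\<lambda>y. g y - M y *v (w + w' (y - x)))"
  have spd: "sym_pos_def (M x)" for x using M by (simp add: riemannian_metric_def)
  have dg: "(g has_derivative frechet_derivative g (at x)) (at x)"
    by (rule C1_has_derivative[OF g])
  have dM: "(M has_derivative frechet_derivative M (at x)) (at x)"
    using M by (simp add: riemannian_metric_def C1_has_derivative)
  have w': "bounded_linear w'"
    unfolding w'_def
    by (intro bounded_linear_compose[OF matrix_vector_mul_bounded_linear] bounded_linear_sub
        has_derivative_bounded_linear[OF dg]
        bounded_linear_compose[OF bounded_bilinear.bounded_linear_left[OF bounded_bilinear_matrix_vector_mult]]
        has_derivative_bounded_linear[OF dM])
  have Mw': "M x *v w' v = frechet_derivative g (at x) v - frechet_derivative M (at x) v *v w" for v
    by (simp add: w'_def sym_pos_def_inverse[OF spd])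
  have w'0: "w' 0 = 0" using w' by (rule bounded_linear.linear[THEN linear_0])
  have d: "((\<lambda>y. w + w' (y - x)) has_derivative w') (at x)"
    by (auto intro!: derivative_eq_intros bounded_linear.has_derivative[OF w'])
  have "(G has_derivative (\<lambda>v. frechet_derivative g (at x) v -
      (M x *v w' v + frechet_derivative M (at x) v *v (w + w' (x - x))))) (at x)"
    unfolding G_def by (intro has_derivative_diff dg has_derivative_matrix_vector_mult dM d)
  then have "(G has_derivative (\<lambda>v. 0)) (at x)"
    by (simp add: Mw' w'0)
  moreover have G0: "G x = 0" by (simp add: G_def w'0 w_def sym_pos_def_inverse[OF spd])
  ultimately have lim: "((\<lambda>y. norm (G y) / norm (y - x)) \<longlongrightarrow> 0) (at x)"
    by (simp add: has_derivative_iff_norm)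
  obtain C where C: "0 < C" "\<And>z u. z \<in> cball x 1 \<Longrightarrow> norm (matrix_inv (M z) *v u) \<le> C * norm u"
    using norm_metric_inverse_le[OF M] by metis
  have "((\<lambda>y. C * (norm (G y) / norm (y - x))) \<longlongrightarrow> 0) (at x)"
    using tendsto_mult_right_zero[OF lim] .
  then have "((\<lambda>y. norm (matrix_inv (M y) *v g y - w - w' (y - x)) / norm (y - x)) \<longlongrightarrow> 0) (at x)"
  proof (rule Lim_null_comparison[rotated])
    have "\<forall>\<^sub>F y in at x. y \<in> ball x 1" by (intro eventually_at_in_open') auto
    then show "\<forall>\<^sub>F y in at x. norm (norm (matrix_inv (M y) *v g y - w - w' (y - x)) / norm (y - x))
        \<le> C * (norm (G y) / norm (y - x))"
    proof eventually_elim
      case (elim y)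
      have "matrix_inv (M y) *v g y - w - w' (y - x) = matrix_inv (M y) *v G y"
        by (simp add: G_def matrix_vector_mult_diff_distrib sym_pos_def_inverse[OF spd])
      then have "norm (matrix_inv (M y) *v g y - w - w' (y - x)) \<le> C * norm (G y)"
        using C(2)[of y "G y"] elim by (simp add: less_imp_le)
      then show ?case by (simp add: divide_right_mono)
    qed
  qed
  then show ?thesis
    using w' by (simp add: has_derivative_iff_norm w_def w'_def)
qed

lemma C1_metric_inverse:
  assumes M: "riemannian_metric M" and g: "C1 g"
  shows "C1 (\<lambda>y. matrix_inv (M y) *v g y)"
proof (rule C1I[OF has_derivative_metric_inverse[OF assms]])
  have "C1 M" using M by (simp add: riemannian_metric_def)
  then show "continuous_on UNIV (\<lambda>x. matrix_inv (M x) *v (frechet_derivative g (at x) v -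
         frechet_derivative M (at x) v *v (matrix_inv (M x) *v g x)))" for v
    using g by (intro continuous_on_metric_inverse[OF M] continuous_intros C1_continuous_on
        continuous_on_C1_derivative)
qed

lemma natural_gradient_C1:
  assumes "C2 f" "riemannian_metric M"
  shows "C1 (\<lambda>x. natural_gradient M f x t)"
proof -
  have C: "C1 (\<lambda>y. matrix_inv (M y) *v grad f y)"
    using assms by (intro C1_metric_inverse) (auto simp: C2_def)
  show ?thesis
    unfolding natural_gradient_def
    by (rule C1I[OF has_derivative_minus[OF C1_has_derivative[OF C]]])
       (intro continuous_intros continuous_on_C1_derivative C)
qed

section \<open>Gradients, and the contraction inequality for vectors\<close>

lemma has_derivative_grad:
  assumes "C1 f"
  shows "(f has_derivative (\<lambda>v. grad f x \<bullet> v)) (at x)"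
proof -
  interpret linear "frechet_derivative f (at x)"
    using C1_has_derivative[OF assms] has_derivative_linear by blast
  have "frechet_derivative f (at x) v = grad f x \<bullet> v" for v
  proof -
    have "frechet_derivative f (at x) v = frechet_derivative f (at x) (\<Sum>i\<in>UNIV. v $ i *\<^sub>R axis i 1)"
      using basis_expansion[of v] by (simp add: scalar_mult_eq_scaleR)
    then show ?thesis by (simp add: sum scale inner_vec_def grad_def mult.commute)
  qed
  then show ?thesis using C1_has_derivative[OF assms, of x] by presburger
qed

text \<open>\<open>metric_rate\<close> is the derivative of \<open>P\<close> in the direction of the
  field, by linearity; symmetry of \<open>P x\<close> makes the two terms with the Jacobian equal,
  hence the factor 2.\<close>

lemma contracting_quadratic_form:
  assumes "contracting h P \<alpha>" and h: "C1 (\<lambda>y. h y t)"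
  shows "v \<bullet> (frechet_derivative P (at x) (h x t) *v v) +
      2 * (frechet_derivative (\<lambda>y. h y t) (at x) v \<bullet> (P x *v v)) \<le> - 2 * \<alpha> * (v \<bullet> (P x *v v))"
proof -
  define A where "A = jacobian (\<lambda>y. h y t) (at x)"
  have P: "C1 P" and spd: "sym_pos_def (P x)"
    using assms by (auto simp: contracting_def riemannian_metric_def)
  interpret linear "frechet_derivative P (at x)"
    using C1_has_derivative[OF P] has_derivative_linear by blast
  have "linear (frechet_derivative (\<lambda>y. h y t) (at x))"
    using C1_has_derivative[OF h] has_derivative_linear by blast
  then have A: "A *v v = frechet_derivative (\<lambda>y. h y t) (at x) v"
    by (simp add: A_def jacobian_def matrix_works)
  have "metric_rate P h x t = frechet_derivative P (at x) (\<Sum>i\<in>UNIV. (h x t $ i) *\<^sub>R axis i 1)"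
    by (simp add: metric_rate_def sum scale)
  also have "\<dots> = frechet_derivative P (at x) (h x t)"
    using basis_expansion[of "h x t"] by (simp add: scalar_mult_eq_scaleR)
  finally have rate: "metric_rate P h x t = frechet_derivative P (at x) (h x t)" .
  have "v \<bullet> ((transpose A ** P x) *v v) = (A *v v) \<bullet> (P x *v v)"
    by (metis dot_lmul_matrix inner_commute matrix_vector_mul_assoc transpose_matrix_vector)
  moreover have "v \<bullet> ((P x ** A) *v v) = (A *v v) \<bullet> (P x *v v)"
    by (metis matrix_vector_mul_assoc metric_form_commute[OF spd])
  moreover have "0 \<le> v \<bullet> (((- 2 * \<alpha>) *\<^sub>R P x - (metric_rate P h x t + transpose A ** P x + P x ** A)) *v v)"
    using assms(1) unfolding contracting_def Let_def A_def loewner_le_def by blast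
  moreover have "((- 2 * \<alpha>) *\<^sub>R P x) *v v = (- 2 * \<alpha>) *\<^sub>R (P x *v v)"
    by (rule scaleR_matrix_vector_assoc[symmetric])
  ultimately show ?thesis
    unfolding rate A matrix_vector_mult_diff_rdistrib matrix_vector_mult_add_rdistrib
      inner_diff_right inner_add_right by simp
qed

section \<open>Contracting flows\<close>

lemma C1_euler_map:
  assumes h: "C1 h"
  shows "C1 (\<lambda>x. x + \<tau> *\<^sub>R h x)"
    and "frechet_derivative (\<lambda>x. x + \<tau> *\<^sub>R h x) (at x) = (\<lambda>v. v + \<tau> *\<^sub>R frechet_derivative h (at x) v)"
proof -
  have d: "((\<lambda>x. x + \<tau> *\<^sub>R h x) has_derivative (\<lambda>v. v + \<tau> *\<^sub>R frechet_derivative h (at x) v)) (at x)" for x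
    by (auto intro!: derivative_eq_intros C1_has_derivative[OF h])
  show "C1 (\<lambda>x. x + \<tau> *\<^sub>R h x)"
    by (rule C1I[OF d]) (intro continuous_intros continuous_on_C1_derivative h)
  show "frechet_derivative (\<lambda>x. x + \<tau> *\<^sub>R h x) (at x) = (\<lambda>v. v + \<tau> *\<^sub>R frechet_derivative h (at x) v)"
    by (rule frechet_derivative_at[OF d, symmetric])
qed

text \<open>Existence of solutions, the equilibrium and the convergence rate hold for any autonomous
  contracting field, so the gradient structure is left out here; it returns only when the
  equilibrium is identified as a minimizer.\<close>

locale contracting_field =
  fixes h :: "real^'n \<Rightarrow> real^'n" and P :: "real^'n \<Rightarrow> real^'n^'n" and \<alpha> :: real
  assumes h: "C1 h" and P: "riemannian_metric P" and complete: "complete_metric P"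
    and \<alpha>: "0 < \<alpha>"
    and contraction: "v \<bullet> (frechet_derivative P (at x) (h x) *v v) +
      2 * (frechet_derivative h (at x) v \<bullet> (P x *v v)) \<le> - 2 * \<alpha> * (v \<bullet> (P x *v v))"
begin

lemma C1_P: "C1 P"
  using P by (simp add: riemannian_metric_def)

lemma spd: "sym_pos_def (P x)"
  using P by (simp add: riemannian_metric_def)

lemma continuous_on_h: "continuous_on S x \<Longrightarrow> continuous_on S (\<lambda>s. h (x s))"
  using continuous_on_compose2[OF C1_continuous_on[OF h, of UNIV]] by blast

lemma solution_continuous_on:
  "(\<And>t. t \<in> S \<Longrightarrow> (x has_vector_derivative h (x t)) (at t within S)) \<Longrightarrow> continuous_on S x"
  by (meson continuous_on_eq_continuous_within has_vector_derivative_continuous)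

text \<open>The derivative of the squared speed \<open>s\<close> is the left-hand side of
  \<open>contraction\<close> at \<open>v = h (x r)\<close>, so
  \<open>exp (2 * \<alpha> * t) * s t\<close> does not increase. A finite interval is used because
  \<open>solution_exists\<close> relies on this before global solutions are available.\<close>

lemma speed_decay:
  assumes x: "\<And>t. t \<in> {0..T} \<Longrightarrow> (x has_vector_derivative h (x t)) (at t within {0..T})"
    and t: "t \<in> {0..T}"
  shows "metric_norm P (x t) (h (x t)) \<le> metric_norm P (x 0) (h (x 0)) * exp (- \<alpha> * t)"
proof -
  define s where "s = (\<lambda>t. h (x t) \<bullet> (P (x t) *v h (x t)))"
  have contx: "continuous_on {0..T} x" by (rule solution_continuous_on[OF x])
  have conts: "continuous_on {0..T} s"
    unfolding s_def
    by (intro continuous_intros continuous_on_h contx continuous_on_compose2[OF C1_continuous_on[OF C1_P, of UNIV] contx]) auto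
  have "exp (2 * \<alpha> * t) * s t \<le> exp (2 * \<alpha> * 0) * s 0"
  proof (rule DERIV_nonpos_imp_decreasing_open[where f = "\<lambda>t. exp (2 * \<alpha> * t) * s t"])
    show "0 \<le> t" using t by simp
    show "continuous_on {0..t} (\<lambda>t. exp (2 * \<alpha> * t) * s t)"
      by (intro continuous_intros continuous_on_subset[OF conts]) (use t in auto)
    fix r assume r: "0 < r" "r < t"
    then have rT: "r \<in> {0<..<T}" "r \<in> {0..T}" using t by auto
    define z where "z = h (x r)"
    define z' where "z' = frechet_derivative h (at (x r)) z"
    define P' where "P' = frechet_derivative P (at (x r)) z"
    have dx: "(x has_vector_derivative z) (at r)"
      using x[OF rT(2)] rT(1) by (simp add: at_within_Icc_at z_def)
    have dh: "((\<lambda>r. h (x r)) has_vector_derivative z') (at r)"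
      using vector_derivative_diff_chain_within[of x z r UNIV h] dx
        has_derivative_at_withinI[OF C1_has_derivative[OF h]] by (simp add: o_def z'_def)
    have dP: "((\<lambda>r. P (x r)) has_vector_derivative P') (at r)"
      using vector_derivative_diff_chain_within[of x z r UNIV P] dx
        has_derivative_at_withinI[OF C1_has_derivative[OF C1_P]] by (simp add: o_def P'_def)
    have "(s has_vector_derivative (z \<bullet> (P (x r) *v z' + P' *v z) + z' \<bullet> (P (x r) *v z))) (at r)"
      unfolding s_def
      using bounded_bilinear.has_vector_derivative[OF bounded_bilinear_inner dh
          has_vector_derivative_matrix_vector_mult[OF dP dh]]
      by (simp add: z_def)
    moreover have "z \<bullet> (P (x r) *v z' + P' *v z) + z' \<bullet> (P (x r) *v z) =
        z \<bullet> (P' *v z) + 2 * (z' \<bullet> (P (x r) *v z))"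
      by (simp add: inner_add_right metric_form_commute[OF spd, of z _ z'])
    ultimately have ds: "(s has_real_derivative z \<bullet> (P' *v z) + 2 * (z' \<bullet> (P (x r) *v z))) (at r)"
      by (simp add: has_real_derivative_iff_has_vector_derivative)
    have sr: "s r = z \<bullet> (P (x r) *v z)" by (simp add: s_def z_def)
    have "z \<bullet> (P' *v z) + 2 * (z' \<bullet> (P (x r) *v z)) \<le> - 2 * \<alpha> * s r"
      using contraction[of z "x r"] by (simp add: sr z_def z'_def P'_def)
    then have "exp (2 * \<alpha> * r) * (z \<bullet> (P' *v z) + 2 * (z' \<bullet> (P (x r) *v z)) + 2 * \<alpha> * s r) \<le> 0"
      by (intro mult_nonneg_nonpos) auto
    moreover have "((\<lambda>t. exp (2 * \<alpha> * t) * s t) has_real_derivative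
        exp (2 * \<alpha> * r) * (z \<bullet> (P' *v z) + 2 * (z' \<bullet> (P (x r) *v z)) + 2 * \<alpha> * s r)) (at r)"
      by (auto intro!: derivative_eq_intros ds simp: algebra_simps)
    ultimately show "\<exists>y. ((\<lambda>t. exp (2 * \<alpha> * t) * s t) has_real_derivative y) (at r) \<and> y \<le> 0"
      by blast
  qed
  then have "s t \<le> s 0 * exp (- (2 * \<alpha> * t))"
    by (simp add: exp_minus field_simps)
  also have "exp (- (2 * \<alpha> * t)) = (exp (- \<alpha> * t))\<^sup>2"
    by (simp flip: exp_double)
  finally have "sqrt (s t) \<le> sqrt (s 0 * (exp (- \<alpha> * t))\<^sup>2)" by (rule real_sqrt_le_mono)
  then show ?thesis by (simp add: real_sqrt_mult s_def metric_norm_def)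
qed

text \<open>The speed is at most \<open>c * exp (- \<alpha> * t)\<close>, whose integral is at most
  \<open>c / \<alpha>\<close> whatever \<open>T\<close> is.\<close>

lemma solution_geodesic_dist_bound:
  assumes x: "\<And>t. t \<in> {0..T} \<Longrightarrow> (x has_vector_derivative h (x t)) (at t within {0..T})"
    and T: "0 \<le> T"
  shows "geodesic_dist P (x 0) (x T) \<le> metric_norm P (x 0) (h (x 0)) / \<alpha>"
proof -
  define c where "c = metric_norm P (x 0) (h (x 0))"
  have contx: "continuous_on {0..T} x" by (rule solution_continuous_on[OF x])
  have c0: "0 \<le> c" by (simp add: c_def metric_norm_nonneg[OF P])
  have int: "(\<lambda>t. metric_norm P (x t) (h (x t))) integrable_on {0..T}"
    by (intro integrable_continuous_real continuous_on_metric_norm P continuous_on_h contx)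
  have "curve_length P x 0 T (integral {0..T} (\<lambda>t. metric_norm P (x t) (h (x t))))"
  \<comment> \<open>At both ends the derivative of the solution is only one-sided.\<close>
  proof (rule curve_lengthI[where S = "{0, T}" and g' = "\<lambda>t. h (x t)"])
    show "(x has_vector_derivative h (x t)) (at t)" if "t \<in> {0..T} - {0, T}" for t
      using x[of t] that by (simp add: at_within_Icc_at)
    show "continuous_on ({0..T} - {0, T}) (\<lambda>t. h (x t))"
      by (intro continuous_on_h continuous_on_subset[OF contx]) auto
  qed (use T contx int in \<open>auto intro: integrable_integral\<close>)
  from geodesic_dist_le_length[OF P this]
  have "geodesic_dist P (x 0) (x T) \<le> integral {0..T} (\<lambda>t. metric_norm P (x t) (h (x t)))" .
  also have "\<dots> \<le> - (c / \<alpha>) * exp (- \<alpha> * T) - - (c / \<alpha>) * exp (- \<alpha> * 0)"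
  proof (rule has_integral_le[OF integrable_integral[OF int]])
    show "((\<lambda>t. c * exp (- \<alpha> * t)) has_integral - (c / \<alpha>) * exp (- \<alpha> * T) - - (c / \<alpha>) * exp (- \<alpha> * 0)) {0..T}"
      by (rule fundamental_theorem_of_calculus[OF T])
         (use \<alpha> in \<open>auto intro!: derivative_eq_intros simp flip: has_real_derivative_iff_has_vector_derivative\<close>)
  qed (use speed_decay[OF x] in \<open>simp add: c_def\<close>)
  also have "\<dots> \<le> c / \<alpha>" using c0 \<alpha> by simp
  finally show ?thesis by (simp add: c_def)
qed

text \<open>Composing \<open>h\<close> with the projection to a large ball gives a bounded, globally
  Lipschitz field \<open>F\<close>, which has a global solution. The distance bound keeps this
  solution inside the ball, where \<open>F\<close> and \<open>h\<close> agree.\<close>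

lemma solution_exists:
  obtains x where "x 0 = x0" "\<And>t. 0 \<le> t \<Longrightarrow> (x has_vector_derivative h (x t)) (at t within {0..})"
proof -
  define c where "c = metric_norm P x0 (h x0) / \<alpha>"
  have c0: "0 \<le> c" using metric_norm_nonneg[OF P] \<alpha> by (simp add: c_def)
  \<comment> \<open>Solutions travel at most \<open>c\<close>; the surplus 1 makes the resulting
    norm bound strict.\<close>
  obtain R where R: "0 < R" "\<And>y. geodesic_dist P x0 y < c + 1 \<Longrightarrow> norm y < R"
  proof -
    obtain B where "0 < B" "\<forall>y\<in>{y. geodesic_dist P x0 y < c + 1}. norm y \<le> B"
      using bounded_geodesic_ball[OF P complete] unfolding bounded_pos by blast
    then show ?thesis using that[of "B + 1"] by force
  qed
  define F where "F = (\<lambda>x. h (closest_point (cball 0 R) x))"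
  have ball: "closed (cball (0::real^'n) R)" "cball (0::real^'n) R \<noteq> {}" using R by auto
  obtain L where L: "0 < L" "L-lipschitz_on (cball 0 R) h"
    using C1_lipschitz_cball[OF h] by blast
  have "L-lipschitz_on UNIV F"
  proof (rule lipschitz_onI)
    fix x y
    have "dist (F x) (F y) \<le> L * dist (closest_point (cball 0 R) x) (closest_point (cball 0 R) y)"
      unfolding F_def by (intro lipschitz_onD[OF L(2)] closest_point_in_set ball)
    also have "\<dots> \<le> L * dist x y"
      using closest_point_lipschitz[OF convex_cball ball] L(1) by simp
    finally show "dist (F x) (F y) \<le> L * dist x y" .
  qed (use L in simp)
  moreover obtain B where "\<And>x. norm (F x) \<le> B"
  proof -
    have "bounded (h ` cball 0 R)"
      by (intro compact_imp_bounded compact_continuous_image C1_continuous_on h compact_cball)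
    then obtain B where "\<And>x. x \<in> cball 0 R \<Longrightarrow> norm (h x) \<le> B"
      unfolding bounded_iff by blast
    then show ?thesis using that closest_point_in_set[OF ball] unfolding F_def by blast
  qed
  ultimately obtain x where x0: "x 0 = x0"
    and x: "\<And>t. 0 \<le> t \<Longrightarrow> (x has_vector_derivative F (x t)) (at t within {0..})"
    using global_lipschitz_ode_solution[OF _ L(1)] by metis
  have contx: "continuous_on {0..} x"
    using x unfolding continuous_on_eq_continuous_within
    by (auto intro: has_vector_derivative_continuous)
  have F: "F z = h z" if "norm z \<le> R" for z
    using that by (simp add: F_def closest_point_self)
  \<comment> \<open>The bootstrap: staying in the closed ball up to time \<open>t\<close> implies
    being in its interior at time \<open>t\<close>. The sphere is therefore never reached.\<close>
  have escape: "norm (x t) < R" if t: "0 \<le> t" "\<And>s. s \<in> {0..t} \<Longrightarrow> norm (x s) \<le> R" for t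
  proof -
    have "(x has_vector_derivative h (x s)) (at s within {0..t})" if "s \<in> {0..t}" for s
      using has_vector_derivative_within_subset[OF x[of s], of "{0..t}"] F[OF t(2)[OF that]] that by auto
    from solution_geodesic_dist_bound[OF this t(1)]
    have "geodesic_dist P x0 (x t) \<le> c" by (simp add: x0 c_def)
    then show ?thesis using R(2) by simp
  qed
  have bound: "norm (x t) \<le> R" if t: "0 \<le> t" for t
  proof (rule ccontr)
    assume "\<not> norm (x t) \<le> R"
    \<comment> \<open>The least element of \<open>Z\<close> is the first time at which the solution
      is on or outside the sphere; there \<open>escape\<close> is contradicted.\<close>
    define Z where "Z = {s \<in> {0..t}. R \<le> norm (x s)}"
    have cont: "continuous_on {0..t} (\<lambda>s. norm (x s))"
      by (intro continuous_intros continuous_on_subset[OF contx]) auto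
    have "closed Z"
      unfolding Z_def using continuous_closed_preimage[OF cont closed_atLeastAtMost closed_atLeast[of R]]
      by (simp add: vimage_def Int_def)
    then have "compact ({0..t} \<inter> Z)" by (rule compact_Int_closed[OF compact_Icc])
    moreover have "{0..t} \<inter> Z = Z" by (auto simp: Z_def)
    ultimately have Z: "compact Z" by simp
    have "Z \<noteq> {}" using t \<open>\<not> norm (x t) \<le> R\<close> by (auto simp: Z_def intro!: exI[of _ t])
    then obtain s where s: "s \<in> Z" "\<And>r. r \<in> Z \<Longrightarrow> s \<le> r"
      using compact_attains_inf[OF Z] by blast
    have before: "norm (x r) < R" if "r \<in> {0..<s}" for r
      using s(2)[of r] that s(1) by (force simp: Z_def not_le)
    have x0R: "norm (x 0) < R" using escape[of 0] R(2)[of x0] geodesic_dist_refl[OF P] c0 x0 by simp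
    then have "0 < s" using s(1) by (cases "s = 0") (auto simp: Z_def)
    have "norm (x s) = R"
    proof -
      have "\<exists>u\<ge>0. u \<le> s \<and> norm (x u) = R"
        by (rule IVT') (use s(1) x0R in \<open>auto simp: Z_def intro: continuous_on_subset[OF cont]\<close>)
      then obtain u where u: "0 \<le> u" "u \<le> s" "norm (x u) = R" by blast
      then have "u = s" using before[of u] by force
      then show ?thesis using u by simp
    qed
    moreover have "norm (x s) < R"
    proof (rule escape)
      show "norm (x r) \<le> R" if "r \<in> {0..s}" for r
        using before[of r] that \<open>norm (x s) = R\<close> by (cases "r = s") auto
    qed (use \<open>0 < s\<close> in simp)
    ultimately show False by simp
  qed
  show ?thesis using that[of x] x0 x F bound by metis
qed

text \<open>Any limit point of the solution at integer times will do: the speed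
  \<open>metric_norm P y (h y)\<close> is continuous in \<open>y\<close> and tends to 0 along the
  solution.\<close>

lemma equilibrium_exists:
  obtains q where "h q = 0"
proof -
  obtain x where x: "\<And>t. 0 \<le> t \<Longrightarrow> (x has_vector_derivative h (x t)) (at t within {0..})"
    using solution_exists by metis
  have x': "(x has_vector_derivative h (x t)) (at t within {0..T})" if "t \<in> {0..T}" for t T
    using has_vector_derivative_within_subset[OF x[of t], of "{0..T}"] that by auto
  define c where "c = metric_norm P (x 0) (h (x 0))"
  have "geodesic_dist P (x 0) (x (real n)) < c / \<alpha> + 1" for n
    using solution_geodesic_dist_bound[OF x', of "real n"] by (simp add: c_def)
  then have "bounded (range (\<lambda>n. x (real n)))"
    by (intro bounded_subset[OF bounded_geodesic_ball[OF P complete]]) auto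
  then obtain q r where r: "strict_mono (r :: nat \<Rightarrow> nat)" and lim: "((\<lambda>n. x (real n)) \<circ> r) \<longlonglongrightarrow> q"
    using bounded_imp_convergent_subsequence by blast
  have "isCont (\<lambda>y. metric_norm P y (h y)) q"
    using continuous_on_metric_norm[OF P continuous_on_id continuous_on_h[OF continuous_on_id], of UNIV]
    by (simp add: continuous_on_eq_continuous_at)
  from isCont_tendsto_compose[OF this lim]
  have "(\<lambda>n. metric_norm P (x (real (r n))) (h (x (real (r n))))) \<longlonglongrightarrow> metric_norm P q (h q)"
    by (simp add: o_def)
  moreover have "(\<lambda>n. metric_norm P (x (real (r n))) (h (x (real (r n))))) \<longlonglongrightarrow> 0"
  proof (rule Lim_null_comparison)
    have "metric_norm P (x t) (h (x t)) \<le> c * exp (- \<alpha> * t)" if "0 \<le> t" for t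
      using speed_decay[OF x', of t t] that by (simp add: c_def)
    then show "\<forall>\<^sub>F n in sequentially. norm (metric_norm P (x (real (r n))) (h (x (real (r n))))) \<le> c * exp (- \<alpha> * real (r n))"
      using metric_norm_nonneg[OF P] by simp
    have "filterlim (\<lambda>n. \<alpha> * real (r n)) at_top sequentially"
      using \<alpha> r by (intro filterlim_tendsto_pos_mult_at_top[OF tendsto_const]
        filterlim_compose[OF filterlim_real_sequentially] filterlim_subseq) auto
    then have "(\<lambda>n. exp (- (\<alpha> * real (r n)))) \<longlonglongrightarrow> 0"
      by (intro filterlim_compose[OF exp_at_bot]) (simp add: filterlim_uminus_at_top)
    from tendsto_mult_right_zero[OF this, of c]
    show "(\<lambda>n. c * exp (- \<alpha> * real (r n))) \<longlonglongrightarrow> 0" by simp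
  qed
  ultimately have "metric_norm P q (h q) = 0" by (rule LIMSEQ_unique)
  then have "h q = 0"
    using spd[of q] by (auto simp: metric_norm_def sym_pos_def_def)
  then show ?thesis by (rule that)
qed

section \<open>Euler steps and exponential convergence\<close>

text \<open>As a function \<phi> of \<tau>, the form of the transported vector has derivative at
  most \<open>- 2 * \<alpha> * \<phi> 0\<close> at 0, by \<open>contraction\<close>. Uniform
  continuity of the derivative in time, point and unit direction controls it for small \<tau>, and
  the mean value theorem integrates it.\<close>

lemma euler_step_form:
  assumes K: "compact K" and e: "0 < e"
  obtains \<tau>0 where "0 < \<tau>0"
    "\<And>\<tau> x v. \<lbrakk>0 \<le> \<tau>; \<tau> < \<tau>0; x \<in> K; norm v = 1\<rbrakk> \<Longrightarrow>
       (v + \<tau> *\<^sub>R frechet_derivative h (at x) v) \<bullet>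
         (P (x + \<tau> *\<^sub>R h x) *v (v + \<tau> *\<^sub>R frechet_derivative h (at x) v))
       \<le> (1 - 2 * \<alpha> * \<tau> + e * \<tau>) * (v \<bullet> (P x *v v))"
proof -
  obtain m B where m: "0 < m" "\<And>x v. x \<in> K \<Longrightarrow> m\<^sup>2 * (norm v)\<^sup>2 \<le> v \<bullet> (P x *v v)"
    using metric_form_compact_bounds[OF P K] by metis
  define E where "E = (\<lambda>\<tau> x. x + \<tau> *\<^sub>R h x)"
  define w where "w = (\<lambda>\<tau> x v. v + \<tau> *\<^sub>R frechet_derivative h (at x) v)"
  define \<phi>' where "\<phi>' = (\<lambda>\<tau> x v. w \<tau> x v \<bullet> (frechet_derivative P (at (E \<tau> x)) (h x) *v w \<tau> x v) +
      2 * (frechet_derivative h (at x) v \<bullet> (P (E \<tau> x) *v w \<tau> x v)))"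
  let ?C = "{0..1::real} \<times> K \<times> sphere (0::real^'n) 1"
  have "continuous_on ?C (\<lambda>z. \<phi>' (fst z) (fst (snd z)) (snd (snd z)))"
    unfolding \<phi>'_def w_def E_def
    by (intro continuous_intros continuous_on_C1_derivative C1_P h continuous_on_h
        continuous_on_compose2[OF C1_continuous_on[OF C1_P, of UNIV]]) auto
  moreover have "compact ?C" by (intro compact_Times K) auto
  ultimately have "uniformly_continuous_on ?C (\<lambda>z. \<phi>' (fst z) (fst (snd z)) (snd (snd z)))"
    by (rule compact_uniformly_continuous)
  \<comment> \<open>The tolerance is chosen so that the additive error is at most
    \<open>e * \<phi> 0\<close>, since \<open>m\<^sup>2 \<le> \<phi> 0\<close> for unit
    vectors.\<close>
  moreover have "0 < e * m\<^sup>2" using e m by simp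
  ultimately obtain d where d: "0 < d" "\<And>z z'. \<lbrakk>z \<in> ?C; z' \<in> ?C; dist z' z < d\<rbrakk> \<Longrightarrow>
      dist (\<phi>' (fst z') (fst (snd z')) (snd (snd z'))) (\<phi>' (fst z) (fst (snd z)) (snd (snd z))) < e * m\<^sup>2"
    unfolding uniformly_continuous_on_def by metis
  show ?thesis
  proof (rule that[of "min 1 d"])
    fix \<tau> x and v :: "real^'n"
    assume \<tau>: "0 \<le> \<tau>" "\<tau> < min 1 d" and x: "x \<in> K" and v: "norm v = 1"
    define \<phi> where "\<phi> = (\<lambda>\<tau>. w \<tau> x v \<bullet> (P (E \<tau> x) *v w \<tau> x v))"
    have d\<phi>: "(\<phi> has_real_derivative \<phi>' r x v) (at r)" for r
    proof -
      have dE: "((\<lambda>\<tau>. E \<tau> x) has_vector_derivative h x) (at r)"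
        unfolding E_def by (auto intro!: derivative_eq_intros)
      have dw: "((\<lambda>\<tau>. w \<tau> x v) has_vector_derivative frechet_derivative h (at x) v) (at r)"
        unfolding w_def by (auto intro!: derivative_eq_intros)
      have dP: "((\<lambda>\<tau>. P (E \<tau> x)) has_vector_derivative frechet_derivative P (at (E r x)) (h x)) (at r)"
        using vector_derivative_diff_chain_within[of "\<lambda>\<tau>. E \<tau> x" "h x" r UNIV P] dE
          has_derivative_at_withinI[OF C1_has_derivative[OF C1_P]] by (simp add: o_def)
      have "(\<phi> has_vector_derivative
          w r x v \<bullet> (P (E r x) *v frechet_derivative h (at x) v + frechet_derivative P (at (E r x)) (h x) *v w r x v)
          + frechet_derivative h (at x) v \<bullet> (P (E r x) *v w r x v)) (at r)"
        unfolding \<phi>_def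
        by (rule bounded_bilinear.has_vector_derivative[OF bounded_bilinear_inner dw
            has_vector_derivative_matrix_vector_mult[OF dP dw]])
      moreover have "w r x v \<bullet> (P (E r x) *v frechet_derivative h (at x) v + frechet_derivative P (at (E r x)) (h x) *v w r x v)
          + frechet_derivative h (at x) v \<bullet> (P (E r x) *v w r x v) = \<phi>' r x v"
        using metric_form_commute[OF spd, of "w r x v" "E r x" "frechet_derivative h (at x) v"]
        by (simp add: \<phi>'_def inner_add_right)
      ultimately show ?thesis by (simp add: has_real_derivative_iff_has_vector_derivative)
    qed
    have \<phi>0: "\<phi> 0 = v \<bullet> (P x *v v)" by (simp add: \<phi>_def w_def E_def)
    have "\<phi>' 0 x v \<le> - 2 * \<alpha> * \<phi> 0"
      using contraction[of v x] by (simp add: \<phi>'_def w_def E_def \<phi>0)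
    moreover have "m\<^sup>2 \<le> \<phi> 0" using m(2)[OF x, of v] v by (simp add: \<phi>0)
    then have "e * m\<^sup>2 \<le> e * \<phi> 0" using e by (intro mult_left_mono) auto
    ultimately have "\<phi>' 0 x v + e * m\<^sup>2 \<le> (- 2 * \<alpha> + e) * \<phi> 0"
      by (simp add: algebra_simps)
    moreover have "\<phi>' r x v \<le> \<phi>' 0 x v + e * m\<^sup>2" if "0 \<le> r" "r \<le> \<tau>" for r
      using d(2)[of "(0, x, v)" "(r, x, v)"] \<tau> x v that by (auto simp: dist_Pair_Pair dist_real_def)
    ultimately have le: "\<phi>' r x v \<le> (- 2 * \<alpha> + e) * \<phi> 0" if "0 \<le> r" "r \<le> \<tau>" for r
      using that by (meson order_trans)
    have "\<phi> \<tau> - \<phi> 0 \<le> (- 2 * \<alpha> + e) * \<phi> 0 * \<tau>"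
    proof (cases "\<tau> = 0")
      case False
      then obtain r where r: "0 < r" "r < \<tau>" "\<phi> \<tau> - \<phi> 0 = (\<tau> - 0) * \<phi>' r x v"
        using MVT2[of 0 \<tau> \<phi> "\<lambda>r. \<phi>' r x v"] d\<phi> \<tau> by auto
      then show ?thesis
        using mult_left_mono[OF le[of r] \<tau>(1)] by (simp add: mult.commute)
    qed simp
    then show "(v + \<tau> *\<^sub>R frechet_derivative h (at x) v) \<bullet>
         (P (x + \<tau> *\<^sub>R h x) *v (v + \<tau> *\<^sub>R frechet_derivative h (at x) v))
       \<le> (1 - 2 * \<alpha> * \<tau> + e * \<tau>) * (v \<bullet> (P x *v v))"
      by (simp add: \<phi>0[symmetric]) (simp add: \<phi>_def w_def E_def algebra_simps)
  qed (use d in simp)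
qed

lemma euler_step_norm:
  assumes K: "compact K" and e: "0 < e"
  obtains \<tau>0 where "0 < \<tau>0" "\<tau>0 * \<alpha> \<le> 1"
    "\<And>\<tau> x v. \<lbrakk>0 \<le> \<tau>; \<tau> < \<tau>0; x \<in> K\<rbrakk> \<Longrightarrow>
       metric_norm P (x + \<tau> *\<^sub>R h x) (v + \<tau> *\<^sub>R frechet_derivative h (at x) v)
       \<le> (1 - (\<alpha> - e) * \<tau>) * metric_norm P x v"
proof -
  obtain \<tau>1 where \<tau>1: "0 < \<tau>1"
    "\<And>\<tau> x v. \<lbrakk>0 \<le> \<tau>; \<tau> < \<tau>1; x \<in> K; norm v = 1\<rbrakk> \<Longrightarrow>
       (v + \<tau> *\<^sub>R frechet_derivative h (at x) v) \<bullet>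
         (P (x + \<tau> *\<^sub>R h x) *v (v + \<tau> *\<^sub>R frechet_derivative h (at x) v))
       \<le> (1 - 2 * \<alpha> * \<tau> + (2 * e) * \<tau>) * (v \<bullet> (P x *v v))"
    using euler_step_form[OF K, of "2 * e"] e by auto
  show ?thesis
  \<comment> \<open>The bound \<open>1 / \<alpha>\<close> keeps the factor \<open>k\<close>
    nonnegative, so that the square root of \<open>k\<^sup>2\<close> is \<open>k\<close>. The
    doubled \<open>e\<close> above is halved again by \<open>1 - 2 * y \<le> (1 - y)\<^sup>2\<close>
    with \<open>y = (\<alpha> - e) * \<tau>\<close>.\<close>
  proof (rule that[of "min \<tau>1 (1 / \<alpha>)"])
    show "0 < min \<tau>1 (1 / \<alpha>)" "min \<tau>1 (1 / \<alpha>) * \<alpha> \<le> 1"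
      using \<tau>1 \<alpha> by (auto simp: min_def field_simps)
    fix \<tau> x and v :: "real^'n"
    assume \<tau>: "0 \<le> \<tau>" "\<tau> < min \<tau>1 (1 / \<alpha>)" and x: "x \<in> K"
    define k where "k = 1 - (\<alpha> - e) * \<tau>"
    have "\<alpha> * \<tau> < 1" using \<tau> \<alpha> by (simp add: field_simps)
    moreover have "0 \<le> e * \<tau>" using e \<tau> by simp
    ultimately have k: "0 \<le> k" unfolding k_def by (simp add: left_diff_distrib)
    have *: "1 - 2 * \<alpha> * \<tau> + (2 * e) * \<tau> \<le> k\<^sup>2"
    proof -
      have "1 - 2 * \<alpha> * \<tau> + (2 * e) * \<tau> = 1 - 2 * ((\<alpha> - e) * \<tau>)" by (simp add: algebra_simps)
      then show ?thesis
        using zero_le_power2[of "(\<alpha> - e) * \<tau>"] by (simp add: k_def power2_diff)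
    qed
    let ?w = "\<lambda>v. v + \<tau> *\<^sub>R frechet_derivative h (at x) v"
    have unit: "metric_norm P (x + \<tau> *\<^sub>R h x) (?w v) \<le> k * metric_norm P x v" if "norm v = 1" for v
    proof -
      have "?w v \<bullet> (P (x + \<tau> *\<^sub>R h x) *v ?w v) \<le> k\<^sup>2 * (v \<bullet> (P x *v v))"
        using \<tau>1(2)[OF \<tau>(1) _ x that] \<tau>(2) mult_right_mono[OF * metric_form_nonneg[OF spd, of v x]]
        by simp
      then have "sqrt (?w v \<bullet> (P (x + \<tau> *\<^sub>R h x) *v ?w v)) \<le> sqrt (k\<^sup>2 * (v \<bullet> (P x *v v)))"
        by (rule real_sqrt_le_mono)
      then show ?thesis using k by (simp add: metric_norm_def real_sqrt_mult)
    qed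
    show "metric_norm P (x + \<tau> *\<^sub>R h x) (?w v) \<le> (1 - (\<alpha> - e) * \<tau>) * metric_norm P x v"
    proof (cases "v = 0")
      case True
      have "linear (frechet_derivative h (at x))"
        using C1_has_derivative[OF h] has_derivative_linear by blast
      then show ?thesis using True by (simp add: linear_0 metric_norm_def)
    next
      case False
      define u where "u = (1 / norm v) *\<^sub>R v"
      have u: "norm u = 1" "v = norm v *\<^sub>R u" using False by (auto simp: u_def)
      have "linear (frechet_derivative h (at x))"
        using C1_has_derivative[OF h] has_derivative_linear by blast
      then have "?w v = norm v *\<^sub>R ?w u"
        by (subst (1 2) u(2)) (simp add: linear_scale scaleR_add_right)
      then have "metric_norm P (x + \<tau> *\<^sub>R h x) (?w v) = norm v * metric_norm P (x + \<tau> *\<^sub>R h x) (?w u)"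
        by (simp only: metric_norm_scaleR) simp
      also have "\<dots> \<le> norm v * (k * metric_norm P x u)"
        using unit[OF u(1)] by (intro mult_left_mono) auto
      also have "\<dots> = k * metric_norm P x v"
      proof -
        have "metric_norm P x v = norm v * metric_norm P x u"
          by (subst u(2)) (simp add: metric_norm_scaleR)
        then show ?thesis by simp
      qed
      finally show ?thesis by (simp add: k_def)
    qed
  qed
qed

text \<open>A curve from \<open>q\<close> of length less than \<rho> stays in the ball of radius
  \<rho>, whose closure \<open>K\<close> is compact. So one step size serves all such curves, and
  their images start at \<open>q\<close> again because \<open>h q = 0\<close>.\<close>

lemma euler_step_geodesic_dist:
  assumes q: "h q = 0" and e: "0 < e"
  obtains \<tau>0 where "0 < \<tau>0" "\<tau>0 * \<alpha> \<le> 1"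
    "\<And>\<tau> x. \<lbrakk>0 \<le> \<tau>; \<tau> < \<tau>0; geodesic_dist P q x < \<rho>\<rbrakk> \<Longrightarrow>
       geodesic_dist P q (x + \<tau> *\<^sub>R h x) \<le> (1 - (\<alpha> - e) * \<tau>) * geodesic_dist P q x"
proof -
  define K where "K = closure {y. geodesic_dist P q y < \<rho>}"
  have "compact K"
    unfolding K_def using bounded_geodesic_ball[OF P complete] by (simp add: compact_closure)
  then obtain \<tau>0 where \<tau>0: "0 < \<tau>0" "\<tau>0 * \<alpha> \<le> 1"
    "\<And>\<tau> x v. \<lbrakk>0 \<le> \<tau>; \<tau> < \<tau>0; x \<in> K\<rbrakk> \<Longrightarrow>
       metric_norm P (x + \<tau> *\<^sub>R h x) (v + \<tau> *\<^sub>R frechet_derivative h (at x) v)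
       \<le> (1 - (\<alpha> - e) * \<tau>) * metric_norm P x v"
    using euler_step_norm[OF _ e] by metis
  show ?thesis
  proof (rule that[OF \<tau>0(1,2)])
    fix \<tau> x
    assume \<tau>: "0 \<le> \<tau>" "\<tau> < \<tau>0" and x: "geodesic_dist P q x < \<rho>"
    define k where "k = 1 - (\<alpha> - e) * \<tau>"
    have "\<alpha> * \<tau> \<le> \<tau>0 * \<alpha>" using \<tau> \<alpha> by simp
    moreover have "0 \<le> e * \<tau>" using e \<tau> by simp
    ultimately have k: "0 \<le> k" unfolding k_def using \<tau>0(2) by (simp add: left_diff_distrib)
    have step: "geodesic_dist P q (x + \<tau> *\<^sub>R h x) \<le> k * L" if L: "geodesic_dist P q x < L" "L \<le> \<rho>" for L
    proof -
      obtain g L' where g: "curve_length P g 0 1 L'" "g 0 = q" "g 1 = x" "L' < L"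
        using geodesic_dist_less_curve[OF P L(1)] by metis
      obtain len where len: "\<And>s. s \<in> {0..1} \<Longrightarrow> curve_length P g 0 s (len s)"
        "\<And>s. s \<in> {0..1} \<Longrightarrow> curve_length P g s 1 (L' - len s)"
        using curve_length_split[OF g(1)] by metis
      have "g s \<in> K" if "s \<in> {0..1}" for s
        using geodesic_dist_le_length[OF P len(1)[OF that]] curve_length_nonneg[OF P len(2)[OF that]]
          g L(2) closure_subset[of "{y. geodesic_dist P q y < \<rho>}"]
        unfolding K_def by auto
      then obtain L'' where L'': "curve_length P (\<lambda>s. g s + \<tau> *\<^sub>R h (g s)) 0 1 L''" "L'' \<le> k * L'"
        using curve_length_image[OF P g(1) C1_euler_map(1)[OF h, of \<tau>], of k] \<tau>0(3)[OF \<tau>]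
        unfolding C1_euler_map(2)[OF h] k_def by blast
      have "geodesic_dist P q (x + \<tau> *\<^sub>R h x) \<le> L''"
        using geodesic_dist_le_length[OF P L''(1)] by (simp add: g q)
      also have "\<dots> \<le> k * L" using L''(2) mult_left_mono[OF less_imp_le[OF g(4)] k] by linarith
      finally show ?thesis .
    qed
    \<comment> \<open>\<open>L\<close> decreases to the distance while remaining strictly above it,
      since the infimum need not be attained.\<close>
    have "((\<lambda>L. k * L) \<longlongrightarrow> k * geodesic_dist P q x) (at_right (geodesic_dist P q x))"
      by (intro tendsto_intros)
    moreover have "\<forall>\<^sub>F L in at_right (geodesic_dist P q x). geodesic_dist P q (x + \<tau> *\<^sub>R h x) \<le> k * L"
      using eventually_at_right_real[OF x] by eventually_elim (use step in auto)
    ultimately show "geodesic_dist P q (x + \<tau> *\<^sub>R h x) \<le> (1 - (\<alpha> - e) * \<tau>) * geodesic_dist P q x"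
      unfolding k_def[symmetric] by (intro tendsto_lowerbound) auto
  qed
qed

text \<open>Each Euler step contracts the distance to \<open>q\<close> by \<open>k\<close>, and the
  solution deviates from the step by at most \<open>B * e * \<tau>\<close>. Summing over
  \<open>[0, T]\<close> leaves the error \<open>B * e * T\<close>. For fixed \<open>e\<close> one
  sufficiently fine subdivision is enough, so only the limit in \<open>e\<close> remains.\<close>

lemma solution_converges:
  assumes q: "h q = 0"
    and x: "\<And>t. 0 \<le> t \<Longrightarrow> (x has_vector_derivative h (x t)) (at t within {0..})"
    and T: "0 \<le> T"
  shows "geodesic_dist P q (x T) \<le> exp (- \<alpha> * T) * geodesic_dist P q (x 0)"
proof (cases "T = 0")
  case False
  then have T0: "0 < T" using T by simp
  define u where "u = (\<lambda>t. geodesic_dist P q (x t))"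
  have x': "(x has_vector_derivative h (x t)) (at t within S)" if "t \<in> S" "S \<subseteq> {0..}" for t S
    using has_vector_derivative_within_subset[OF x[of t], of S] that by auto
  have contx: "continuous_on {0..T} x" by (rule solution_continuous_on[OF x']) auto
  \<comment> \<open>The initial distance plus the total travel of the solution, with strict slack:
    the ball in which every Euler step is applied.\<close>
  define \<rho> where "\<rho> = u 0 + metric_norm P (x 0) (h (x 0)) / \<alpha> + 1"
  have u: "u t < \<rho>" if "0 \<le> t" for t
  proof -
    have "geodesic_dist P (x 0) (x t) \<le> metric_norm P (x 0) (h (x 0)) / \<alpha>"
      by (rule solution_geodesic_dist_bound[OF x' that]) auto
    then show ?thesis
      using geodesic_dist_triangle[OF P, of q "x t" "x 0"] by (simp add: u_def \<rho>_def)
  qed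
  have "bounded (x ` {0..T})" "bounded ((\<lambda>t. h (x t)) ` {0..T})"
    by (intro compact_imp_bounded compact_continuous_image contx continuous_on_h compact_Icc)+
  then obtain R H where R: "\<And>t. t \<in> {0..T} \<Longrightarrow> norm (x t) \<le> R"
    and H: "\<And>t. t \<in> {0..T} \<Longrightarrow> norm (h (x t)) \<le> H"
    unfolding bounded_iff by (metis imageI)
  \<comment> \<open>For step sizes below 1 this convex ball contains both the solution and its Euler
    points, so \<open>B\<close> turns Euclidean errors into geodesic ones independently of
    \<open>e\<close>.\<close>
  obtain m B where B: "0 < B" "\<And>y v. y \<in> cball 0 (R + H) \<Longrightarrow> metric_norm P y v \<le> B * norm v"
    using metric_norm_compact_bounds[OF P compact_cball] by metis
  have main: "u T \<le> exp (- (\<alpha> - e) * T) * u 0 + B * e * T" if e: "0 < e" "e < \<alpha>" for e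
  proof -
    obtain \<tau>0 where \<tau>0: "0 < \<tau>0" "\<tau>0 * \<alpha> \<le> 1"
      "\<And>\<tau> x. \<lbrakk>0 \<le> \<tau>; \<tau> < \<tau>0; geodesic_dist P q x < \<rho>\<rbrakk> \<Longrightarrow>
         geodesic_dist P q (x + \<tau> *\<^sub>R h x) \<le> (1 - (\<alpha> - e) * \<tau>) * geodesic_dist P q x"
      using euler_step_geodesic_dist[OF q e(1)] by metis
    have "uniformly_continuous_on {0..T} (\<lambda>t. h (x t))"
      by (intro compact_uniformly_continuous continuous_on_h contx compact_Icc)
    then obtain d where d: "0 < d"
      "\<And>s t. \<lbrakk>s \<in> {0..T}; t \<in> {0..T}; dist t s < d\<rbrakk> \<Longrightarrow> dist (h (x t)) (h (x s)) < e"
      unfolding uniformly_continuous_on_def using e(1) by metis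
    obtain N where N: "T / min (min \<tau>0 d) 1 < real N" using reals_Archimedean2 by blast
    have pos: "0 < min (min \<tau>0 d) 1" using \<tau>0 d by simp
    have N0: "0 < real N" using N T0 pos by (smt (verit) divide_pos_pos)
    define \<tau> where "\<tau> = T / real N"
    have "T < min (min \<tau>0 d) 1 * real N" using N pos by (simp only: pos_divide_less_eq mult.commute)
    then have "\<tau> < min (min \<tau>0 d) 1" using N0 by (simp only: \<tau>_def pos_divide_less_eq)
    then have \<tau>: "0 < \<tau>" "\<tau> < \<tau>0" "\<tau> < d" "\<tau> < 1" using T0 N0 by (auto simp: \<tau>_def)
    define k where "k = 1 - (\<alpha> - e) * \<tau>"
    have "\<alpha> * \<tau> \<le> \<tau>0 * \<alpha>" using \<tau> \<alpha> by simp
    moreover have "0 < e * \<tau>" using e \<tau> by simp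
    ultimately have k0: "0 \<le> k" unfolding k_def using \<tau>0(2) by (simp add: left_diff_distrib)
    have "0 \<le> (\<alpha> - e) * \<tau>" using e \<tau> by simp
    then have k1: "k \<le> 1" by (simp add: k_def)
    have step: "u (t + \<tau>) \<le> k * u t + B * e * \<tau>" if t: "0 \<le> t" "t + \<tau> \<le> T" for t
    proof -
      define E where "E = x t + \<tau> *\<^sub>R h (x t)"
      have tT: "t \<in> {0..T}" "t + \<tau> \<in> {0..T}" using t \<tau> by auto
      \<comment> \<open>Subtracting the linear motion with frozen velocity leaves a function whose
        derivative is at most \<open>e\<close> in norm; its increment is the one-step error.\<close>
      have "((\<lambda>s. h (x s) - h (x t)) has_integral (x (t + \<tau>) - (t + \<tau>) *\<^sub>R h (x t)) - (x t - t *\<^sub>R h (x t))) {t..t + \<tau>}"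
      proof (rule fundamental_theorem_of_calculus)
        fix s assume "s \<in> {t..t + \<tau>}"
        then have "(x has_vector_derivative h (x s)) (at s within {t..t + \<tau>})"
          using t by (intro x') auto
        then show "((\<lambda>s. x s - s *\<^sub>R h (x t)) has_vector_derivative h (x s) - h (x t)) (at s within {t..t + \<tau>})"
          by (auto intro!: derivative_eq_intros)
      qed (use \<tau> in simp)
      moreover have "norm (h (x s) - h (x t)) \<le> e" if "s \<in> {t..t + \<tau>}" for s
        using d(2)[of t s] that t \<tau> by (auto simp: dist_norm)
      ultimately have "norm ((x (t + \<tau>) - (t + \<tau>) *\<^sub>R h (x t)) - (x t - t *\<^sub>R h (x t))) \<le> e * measure lborel {t..t + \<tau>}"
        using e by (intro has_integral_bound_real) auto
      then have err: "norm (x (t + \<tau>) - E) \<le> e * \<tau>"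
        using \<tau> by (simp add: E_def algebra_simps)
      have "norm E \<le> norm (x t) + \<tau> * norm (h (x t))"
        unfolding E_def using norm_triangle_ineq[of "x t" "\<tau> *\<^sub>R h (x t)"] \<tau> by simp
      also have "\<dots> \<le> R + 1 * H"
        using R[OF tT(1)] H[OF tT(1)] \<tau> by (intro add_mono mult_mono) auto
      finally have "E \<in> cball 0 (R + H)" by simp
      moreover have "x (t + \<tau>) \<in> cball 0 (R + H)"
        using R[OF tT(2)] order_trans[OF norm_ge_zero H[OF tT(1)]] by simp
      ultimately have "geodesic_dist P E (x (t + \<tau>)) \<le> B * norm (x (t + \<tau>) - E)"
        by (intro geodesic_dist_le_norm[OF P convex_cball[of 0 "R + H"] _ _ B(2)]) auto
      also have "\<dots> \<le> B * (e * \<tau>)" using err B(1) by simp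
      finally have "geodesic_dist P E (x (t + \<tau>)) \<le> B * e * \<tau>" by (simp add: mult.assoc)
      moreover have "geodesic_dist P q E \<le> k * u t"
        using \<tau>0(3)[of \<tau> "x t"] \<tau> u[OF t(1)] by (simp add: E_def k_def u_def)
      ultimately show ?thesis
        using geodesic_dist_triangle[OF P, of q "x (t + \<tau>)" E] by (simp add: u_def)
    qed
    have NT: "real N * \<tau> = T" using N0 by (simp add: \<tau>_def)
    have iter: "u (real n * \<tau>) \<le> k ^ n * u 0 + B * e * (real n * \<tau>)" if "n \<le> N" for n
      using that
    proof (induction n)
      case (Suc n)
      have "real (Suc n) * \<tau> \<le> real N * \<tau>" using Suc.prems \<tau> by (intro mult_right_mono) auto
      then have "real n * \<tau> + \<tau> \<le> T" unfolding NT by (simp add: algebra_simps)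
      then have "u (real n * \<tau> + \<tau>) \<le> k * u (real n * \<tau>) + B * e * \<tau>"
        using \<tau> by (intro step) auto
      also have "\<dots> \<le> k * (k ^ n * u 0 + B * e * (real n * \<tau>)) + B * e * \<tau>"
        using Suc k0 B(1) e(1) by (intro add_mono mult_left_mono) auto
      \<comment> \<open>As \<open>k \<le> 1\<close>, errors of earlier steps are not amplified and
        simply add up.\<close>
      also have "\<dots> \<le> k ^ Suc n * u 0 + B * e * (real n * \<tau>) + B * e * \<tau>"
        using mult_right_mono[OF k1, of "B * e * (real n * \<tau>)"] B e \<tau> by (simp add: algebra_simps)
      finally show ?case by (simp add: algebra_simps)
    qed simp
    have "k \<le> exp (- ((\<alpha> - e) * \<tau>))"
      using exp_ge_add_one_self[of "- ((\<alpha> - e) * \<tau>)"] by (simp add: k_def)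
    then have "k ^ N \<le> exp (- ((\<alpha> - e) * \<tau>)) ^ N" using k0 by (rule power_mono)
    also have "\<dots> = exp (- (\<alpha> - e) * T)"
      by (simp add: NT[symmetric] algebra_simps flip: exp_of_nat_mult)
    finally have "k ^ N * u 0 \<le> exp (- (\<alpha> - e) * T) * u 0"
      using geodesic_dist_nonneg[OF P] by (intro mult_right_mono) (auto simp: u_def)
    with iter[of N] show ?thesis by (simp add: NT)
  qed
  have "((\<lambda>e. exp (- (\<alpha> - e) * T) * u 0 + B * e * T) \<longlongrightarrow> exp (- (\<alpha> - 0) * T) * u 0 + B * 0 * T) (at_right 0)"
    by (intro tendsto_intros)
  moreover have "\<forall>\<^sub>F e in at_right 0. u T \<le> exp (- (\<alpha> - e) * T) * u 0 + B * e * T"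
    using eventually_at_right_real[OF \<alpha>] by eventually_elim (use main in auto)
  ultimately have "u T \<le> exp (- (\<alpha> - 0) * T) * u 0 + B * 0 * T"
    by (intro tendsto_lowerbound) auto
  then show ?thesis by (simp add: u_def)
qed simp

text \<open>A second equilibrium is a constant solution, yet its distance to \<open>q\<close> must
  shrink by the factor \<open>exp (- \<alpha>) < 1\<close> up to time 1.\<close>

lemma equilibrium_unique:
  assumes "h q = 0" "h z = 0"
  shows "z = q"
proof -
  have "((\<lambda>_. z) has_vector_derivative h z) (at t within {0..})" for t
    by (simp add: assms)
  from solution_converges[OF assms(1) this zero_le_one]
  have "geodesic_dist P q z \<le> exp (- \<alpha>) * geodesic_dist P q z" by simp
  then have "(1 - exp (- \<alpha>)) * geodesic_dist P q z \<le> 0" by (simp add: algebra_simps)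
  moreover have "0 < 1 - exp (- \<alpha>)" using \<alpha> by simp
  ultimately have "geodesic_dist P q z \<le> 0" by (simp add: mult_le_0_iff)
  then have "geodesic_dist P q z = 0" using geodesic_dist_nonneg[OF P, of q z] by simp
  then show ?thesis
    using Metric_space.zero[OF Metric_space_geodesic_dist[OF P]] by simp
qed

text \<open>Convergence in the Euclidean topology, in which \<open>f\<close> is continuous.\<close>

lemma solution_tendsto:
  assumes q: "h q = 0"
    and x: "\<And>t. 0 \<le> t \<Longrightarrow> (x has_vector_derivative h (x t)) (at t within {0..})"
  shows "(x \<longlongrightarrow> q) at_top"
proof (rule tendstoI)
  fix r :: real assume "0 < r"
  then obtain \<rho> where \<rho>: "0 < \<rho>" "\<And>y. geodesic_dist P q y < \<rho> \<Longrightarrow> norm (y - q) < r"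
    using geodesic_dist_imp_norm_less[OF P] by metis
  have "filterlim (\<lambda>t. \<alpha> * t) at_top at_top"
    using \<alpha> by (intro filterlim_tendsto_pos_mult_at_top[OF tendsto_const] filterlim_ident)
  then have "((\<lambda>t. exp (- (\<alpha> * t))) \<longlongrightarrow> 0) at_top"
    by (intro filterlim_compose[OF exp_at_bot]) (simp add: filterlim_uminus_at_top)
  from tendsto_mult_left_zero[OF this, of "geodesic_dist P q (x 0)"]
  have "\<forall>\<^sub>F t in at_top. exp (- (\<alpha> * t)) * geodesic_dist P q (x 0) < \<rho>"
    using \<rho>(1) by (rule order_tendstoD)
  then show "\<forall>\<^sub>F t in at_top. dist (x t) q < r"
    using eventually_ge_at_top[of 0]
  proof eventually_elim
    case (elim t)
    then have "geodesic_dist P q (x t) < \<rho>" using solution_converges[OF q x, of t] by simp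
    then show ?case using \<rho>(2) by (simp add: dist_norm)
  qed
qed

end

section \<open>Natural gradient systems and the minimizer\<close>

theorem proposition4:
  fixes f :: "real^'n \<Rightarrow> real"
    and M P :: "real^'n \<Rightarrow> real^'n^'n"
    and \<alpha> :: real
  assumes "C2 f"
    and "riemannian_metric M"
    and "contracting (natural_gradient M f) P \<alpha>"
    and "complete_metric P"
  shows "\<exists>xstar. global_minimizer f xstar \<and>
     (\<forall>z. global_minimizer f z \<longrightarrow> z = xstar) \<and>
     (\<forall>x0. \<exists>x. solution (natural_gradient M f) x \<and> x 0 = x0) \<and>
     (\<forall>x. solution (natural_gradient M f) x \<longrightarrow> exp_convergent P \<alpha> x (\<lambda>_. xstar))"
proof -
  define h where "h = (\<lambda>x. natural_gradient M f x 0)"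
  have natural_gradient_eq: "natural_gradient M f = (\<lambda>x t. h x)"
    by (simp add: h_def natural_gradient_def fun_eq_iff)
  have C1_h: "C1 h"
    unfolding h_def by (rule natural_gradient_C1[OF assms(1,2)])
  have C1_f: "C1 f" using assms(1) by (simp add: C2_def)
  have spd_M: "sym_pos_def (M x)" for x using assms(2) by (simp add: riemannian_metric_def)
  have P: "riemannian_metric P" and \<alpha>: "0 < \<alpha>"
    using assms(3) by (auto simp: contracting_def)
  interpret contracting_field h P \<alpha>
  proof
    show "v \<bullet> (frechet_derivative P (at x) (h x) *v v) +
      2 * (frechet_derivative h (at x) v \<bullet> (P x *v v)) \<le> - 2 * \<alpha> * (v \<bullet> (P x *v v))" for x v
      using contracting_quadratic_form[OF assms(3)[unfolded natural_gradient_eq]] C1_h by simp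
  qed (fact C1_h P assms(4) \<alpha>)+
  obtain q where q: "h q = 0" using equilibrium_exists by blast
  have sol: "solution (natural_gradient M f) x \<longleftrightarrow>
      (\<forall>t\<ge>0. (x has_vector_derivative h (x t)) (at t within {0..}))" for x
    by (simp add: solution_def natural_gradient_eq)
  \<comment> \<open>With \<open>w = - h y\<close> the gradient is \<open>M y *v w\<close>, so the
    derivative of \<open>f\<close> along the field is minus the quadratic form of \<open>M y\<close>
    at \<open>w\<close>.\<close>
  have descent: "grad f y \<bullet> h y \<le> 0" for y
  proof -
    define w where "w = matrix_inv (M y) *v grad f y"
    have "M y *v w = grad f y" by (simp add: w_def sym_pos_def_inverse[OF spd_M])
    then have "grad f y \<bullet> h y = - (w \<bullet> (M y *v w))"
      by (simp add: h_def natural_gradient_def inner_commute flip: w_def)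
    then show ?thesis using metric_form_nonneg[OF spd_M] by simp
  qed
  \<comment> \<open>Start a solution at the arbitrary point \<open>x0\<close>: \<open>f\<close> does
    not increase along it and tends to \<open>f q\<close>.\<close>
  have minimal: "f q \<le> f x0" for x0
  proof -
    obtain x where x: "x 0 = x0" "\<And>t. 0 \<le> t \<Longrightarrow> (x has_vector_derivative h (x t)) (at t within {0..})"
      using solution_exists by blast
    have le: "f (x t) \<le> f (x 0)" if t: "0 \<le> t" for t
    proof (rule DERIV_nonpos_imp_decreasing_open[where f = "\<lambda>t. f (x t)", OF t])
      fix r assume r: "0 < r" "r < t"
      have "(x has_vector_derivative h (x r)) (at r)"
        using x(2)[of r] r at_within_interior[of r "{0..}"] by simp
      then have "((\<lambda>t. f (x t)) has_vector_derivative grad f (x r) \<bullet> h (x r)) (at r)"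
        using vector_derivative_diff_chain_within[of x "h (x r)" r UNIV f "\<lambda>v. grad f (x r) \<bullet> v"]
          has_derivative_at_withinI[OF has_derivative_grad[OF C1_f]] by (simp add: o_def)
      then show "\<exists>y. ((\<lambda>t. f (x t)) has_real_derivative y) (at r) \<and> y \<le> 0"
        using descent by (auto simp: has_real_derivative_iff_has_vector_derivative)
    next
      have "continuous_on {0..} x" by (rule solution_continuous_on, rule x(2)) simp
      then have "continuous_on {0..t} x" by (rule continuous_on_subset) auto
      then show "continuous_on {0..t} (\<lambda>t. f (x t))"
        by (intro continuous_on_compose2[OF C1_continuous_on[OF C1_f, of UNIV]]) auto
    qed
    have "isCont f q"
      using C1_continuous_on[OF C1_f, of UNIV] by (simp add: continuous_on_eq_continuous_at)
    then have "((\<lambda>t. f (x t)) \<longlongrightarrow> f q) at_top"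
      using solution_tendsto[OF q x(2)] by (rule isCont_tendsto_compose)
    moreover have "\<forall>\<^sub>F t in at_top. f (x t) \<le> f x0"
      using eventually_ge_at_top[of 0] by eventually_elim (use le x(1) in auto)
    ultimately show ?thesis by (intro tendsto_upperbound) auto
  qed
  have "z = q" if "global_minimizer f z" for z
  proof -
    \<comment> \<open>The derivative vanishes at a minimizer, so \<open>z\<close> is an equilibrium,
      and there is only one.\<close>
    have "(\<lambda>v. grad f z \<bullet> v) = (\<lambda>v. 0)"
      using that by (intro differential_zero_maxmin[of z UNIV f] has_derivative_grad C1_f)
        (auto simp: global_minimizer_def)
    from fun_cong[OF this, of "grad f z"] have "grad f z = 0" by simp
    then have "h z = 0" by (simp add: h_def natural_gradient_def)
    then show ?thesis by (rule equilibrium_unique[OF q])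
  qed
  moreover have "\<exists>x. solution (natural_gradient M f) x \<and> x 0 = x0" for x0
  proof -
    obtain x where "x 0 = x0" "\<And>t. 0 \<le> t \<Longrightarrow> (x has_vector_derivative h (x t)) (at t within {0..})"
      using solution_exists by blast
    then show ?thesis unfolding sol by blast
  qed
  moreover have "exp_convergent P \<alpha> x (\<lambda>_. q)" if "solution (natural_gradient M f) x" for x
  proof -
    have x: "(x has_vector_derivative h (x t)) (at t within {0..})" if "0 \<le> t" for t
      using \<open>solution (natural_gradient M f) x\<close> that unfolding sol by blast
    show ?thesis
      unfolding exp_convergent_def geodesic_dist_commute[OF P, of "x _" q]
      using solution_converges[OF q x] by blast
  qed
  moreover have "global_minimizer f q" using minimal by (simp add: global_minimizer_def)
  ultimately show ?thesis by blast
qed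

end
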